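(* Let $E\subset\mathbb{R}^2$ be the spiral-type domain given in polar coordinates $(r,\varphi)$ by $$E:= \left\{(r,\varphi):\ \frac{1}{(\varphi + \pi) \, \log^2 (\varphi+\pi)} \le r < \frac 1{\varphi\, \log^2 \varphi}, \ 2\pi \le \varphi < \infty\right\}.$$ Then the characteristic function ${\bf 1}_E$ belongs to $B^{1/p}_{p, \infty} (\mathbb{R}^2)$ for all $p \in [1,\infty]$.
   Context: Here $\log=\log_2$, $\log^2 x=(\log x)^2$, and $(r,\varphi)$ stands for the point $(r\cos\varphi,r\sin\varphi)$, with $\varphi$ ranging over $[2\pi,\infty)$ (not reduced modulo $2\pi$). Fix $\varphi_0,\varphi\in\mathcal{S}(\mathbb{R}^n)$ (here $n=2$) with real-valued nonnegative Fourier transforms such that $\mathrm{supp}\,\mathcal{F}\varphi_0\subset\{|\xi|\le 2\}$, $|\mathcal{F}\varphi_0(\xi)|\ge C>0$ for $|\xi|\le 5/3$, $\mathrm{supp}\,\mathcal{F}\varphi\subset\{1/2\le|\xi|\le 2\}$, $|\mathcal{F}\varphi(\xi)|\ge C>0$ for $3/5\le|\xi|\le 5/3$; put $\varphi_j:=2^{jn}\varphi(2^j\cdot)$ for $j\ge 1$. For $s\in\mathbb{R}$ and $p\in(0,\infty]$, the Besov space $B^s_{p,\infty}(\mathbb{R}^n)$ is the set of all $f\in\mathcal{S}'(\mathbb{R}^n)$ with $\|f\|_{B^s_{p,\infty}(\mathbb{R}^n)}:=\sup_{j\in\mathbb{N}_0}2^{js}\|\varphi_j\ast f\|_{L^p(\mathbb{R}^n)}<\infty$.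 *)

theory Defs
  imports "HOL-Analysis.Analysis" "HOL-Probability.Essential_Supremum"
begin

subsection \<open>Schwartz functions\<close>

text \<open>Iterated partial derivatives; a multi-index is represented by a list of basis vectors.\<close>

definition partial_deriv ::
  "'a::euclidean_space \<Rightarrow> ('a \<Rightarrow> complex) \<Rightarrow> ('a \<Rightarrow> complex)" where
  "partial_deriv b f = (\<lambda>x. frechet_derivative f (at x) b)"

definition iter_partial_deriv ::
  "'a::euclidean_space list \<Rightarrow> ('a \<Rightarrow> complex) \<Rightarrow> ('a \<Rightarrow> complex)" where
  "iter_partial_deriv bs f = foldr partial_deriv bs f"

definition smooth_fun :: "('a::euclidean_space \<Rightarrow> complex) \<Rightarrow> bool" where
  "smooth_fun f \<longleftrightarrow>
     (\<forall>bs\<in>lists Basis. \<forall>x. iter_partial_deriv bs f differentiable (at x))"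

definition schwartz_space :: "('a::euclidean_space \<Rightarrow> complex) set" where
  "schwartz_space = {f. smooth_fun f \<and>
     (\<forall>N. \<forall>bs\<in>lists Basis.
        bounded (range (\<lambda>x. (1 + norm x) ^ N *\<^sub>R iter_partial_deriv bs f x)))}"

text \<open>The real-valued supremum is meaningful only on the Schwartz space, where the
  set is bounded above.\<close>

definition schwartz_seminorm :: "nat \<Rightarrow> ('a::euclidean_space \<Rightarrow> complex) \<Rightarrow> real" where
  "schwartz_seminorm N f =
     (SUP (bs, x) \<in> {bs \<in> lists Basis. length bs \<le> N} \<times> UNIV.
        (1 + norm x) ^ N * norm (iter_partial_deriv bs f x))"

text \<open>The normalisation is \<open>(2 \<pi>)\<^sup>-\<^sup>n\<^sup>/\<^sup>2 \<integral> exp (- i x \<xi>) f(x) dx\<close>.\<close>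

definition fourier_transform ::
  "('a::euclidean_space \<Rightarrow> complex) \<Rightarrow> ('a \<Rightarrow> complex)" where
  "fourier_transform f = (\<lambda>\<xi>.
     of_real ((2 * pi) powr (- real DIM('a) / 2)) *
     (LINT x|lborel. exp (- (\<i> * of_real (x \<bullet> \<xi>))) * f x))"

definition fun_support :: "('a::topological_space \<Rightarrow> complex) \<Rightarrow> 'a set" where
  "fun_support f = closure {x. f x \<noteq> 0}"

subsection \<open>Tempered distributions\<close>

text \<open>A distribution is a functional on the Schwartz space; requiring it to be
  \<^const>\<open>extensional\<close> fixes its irrelevant values outside that space.\<close>

definition tempered_distributions ::
  "(('a::euclidean_space \<Rightarrow> complex) \<Rightarrow> complex) set" where
  "tempered_distributions = {T \<in> extensional schwartz_space.
     (\<forall>f\<in>schwartz_space. \<forall>g\<in>schwartz_space. \<forall>a b.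
        T (\<lambda>x. a * f x + b * g x) = a * T f + b * T g) \<and>
     (\<exists>N C. \<forall>f\<in>schwartz_space. norm (T f) \<le> C * schwartz_seminorm N f)}"

text \<open>\<open>T\<close> is the regular distribution generated by the function \<open>f\<close>; the existence of all
  the integrals is part of the condition.\<close>

definition generated_by ::
  "(('a::euclidean_space \<Rightarrow> complex) \<Rightarrow> complex) \<Rightarrow> ('a \<Rightarrow> complex) \<Rightarrow> bool" where
  "generated_by T f \<longleftrightarrow>
     (\<forall>g\<in>schwartz_space. has_bochner_integral lebesgue (\<lambda>x. f x * g x) (T g))"

definition conv_distribution ::
  "('a::euclidean_space \<Rightarrow> complex) \<Rightarrow> (('a \<Rightarrow> complex) \<Rightarrow> complex) \<Rightarrow> ('a \<Rightarrow> complex)" where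
  "conv_distribution \<phi> T = (\<lambda>x. T (\<lambda>y. \<phi> (x - y)))"

subsection \<open>Besov spaces\<close>

text \<open>The \<open>L\<^sup>p\<close> quasi-norm for \<open>0 < p \<le> \<infinity>\<close>, with values in \<open>[0, \<infinity>]\<close>.\<close>

definition Lp_norm :: "ennreal \<Rightarrow> ('a::euclidean_space \<Rightarrow> complex) \<Rightarrow> ennreal" where
  "Lp_norm p f =
     (if p = \<infinity> then esssup lebesgue (\<lambda>x. ennreal (norm (f x)))
      else let I = \<integral>\<^sup>+ x. ennreal (norm (f x) powr enn2real p) \<partial>lebesgue
           in if I = \<infinity> then \<infinity> else ennreal (enn2real I powr (1 / enn2real p)))"

definition admissible_pair ::
  "('a::euclidean_space \<Rightarrow> complex) \<Rightarrow> ('a \<Rightarrow> complex) \<Rightarrow> bool" where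
  "admissible_pair \<phi>0 \<phi> \<longleftrightarrow>
     \<phi>0 \<in> schwartz_space \<and> \<phi> \<in> schwartz_space \<and>
     (\<forall>\<xi>. Im (fourier_transform \<phi>0 \<xi>) = 0 \<and> Re (fourier_transform \<phi>0 \<xi>) \<ge> 0) \<and>
     (\<forall>\<xi>. Im (fourier_transform \<phi> \<xi>) = 0 \<and> Re (fourier_transform \<phi> \<xi>) \<ge> 0) \<and>
     fun_support (fourier_transform \<phi>0) \<subseteq> {\<xi>. norm \<xi> \<le> 2} \<and>
     fun_support (fourier_transform \<phi>) \<subseteq> {\<xi>. 1 / 2 \<le> norm \<xi> \<and> norm \<xi> \<le> 2} \<and>
     (\<exists>C>0. (\<forall>\<xi>. norm \<xi> \<le> 5 / 3 \<longrightarrow> norm (fourier_transform \<phi>0 \<xi>) \<ge> C) \<and>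
             (\<forall>\<xi>. 3 / 5 \<le> norm \<xi> \<and> norm \<xi> \<le> 5 / 3 \<longrightarrow>
                norm (fourier_transform \<phi> \<xi>) \<ge> C))"

definition dyadic ::
  "('a::euclidean_space \<Rightarrow> complex) \<Rightarrow> ('a \<Rightarrow> complex) \<Rightarrow> nat \<Rightarrow> ('a \<Rightarrow> complex)" where
  "dyadic \<phi>0 \<phi> j =
     (if j = 0 then \<phi>0 else (\<lambda>x. 2 ^ (j * DIM('a)) * \<phi> (2 ^ j *\<^sub>R x)))"

definition besov_norm ::
  "('a::euclidean_space \<Rightarrow> complex) \<Rightarrow> ('a \<Rightarrow> complex) \<Rightarrow> real \<Rightarrow> ennreal \<Rightarrow>
   (('a \<Rightarrow> complex) \<Rightarrow> complex) \<Rightarrow> ennreal" where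
  "besov_norm \<phi>0 \<phi> s p T =
     (SUP j. ennreal (2 powr (real j * s)) * Lp_norm p (conv_distribution (dyadic \<phi>0 \<phi> j) T))"

text \<open>The space \<open>B\<^sup>s\<close> with integrability \<open>p\<close> and fine index \<open>\<infinity>\<close>, for \<open>0 < p \<le> \<infinity>\<close>.\<close>

definition besov_space ::
  "('a::euclidean_space \<Rightarrow> complex) \<Rightarrow> ('a \<Rightarrow> complex) \<Rightarrow> real \<Rightarrow> ennreal \<Rightarrow>
   (('a \<Rightarrow> complex) \<Rightarrow> complex) set" where
  "besov_space \<phi>0 \<phi> s p = {T \<in> tempered_distributions. besov_norm \<phi>0 \<phi> s p T < \<infinity>}"

subsection \<open>The spiral domain\<close>

text \<open>The angle \<open>t\<close> is not reduced modulo \<open>2 \<pi>\<close>.\<close>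

definition spiral_domain :: "(real ^ 2) set" where
  "spiral_domain =
     {vector [r * cos t, r * sin t] | r t.
        1 / ((t + pi) * (log 2 (t + pi))\<^sup>2) \<le> r \<and> r < 1 / (t * (log 2 t)\<^sup>2) \<and> 2 * pi \<le> t}"

end

theory Submission
  imports Defs
begin

text \<open>
The domain is bounded by two arms of a spiral whose turns have radii comparable to
\<open>1 / (k * (ln k)\<^sup>2)\<close>. These radii, hence the lengths of the turns, are summable, so the
frontier has finite length although it winds around the origin infinitely often. An indicator of a
set of finite perimeter has an \<open>L\<^sup>1\<close> modulus of continuity of order \<open>norm z\<close>, which is smoothness \<open>1\<close>
in \<open>L\<^sup>1\<close>; it is also bounded, which is smoothness \<open>0\<close> in \<open>L\<^sup>\<infinity>\<close>. Interpolating between the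
two for every frequency block gives smoothness \<open>1/p\<close> in \<open>L\<^sup>p\<close>.

Finite length is used in the form of Minkowski content: the \<open>h\<close>-neighbourhood of the frontier has
measure at most \<open>C * h\<close> (\<open>spiral_frontier_content\<close>). A turn longer than \<open>h\<close> is
covered by balls of radius \<open>2 * h\<close> in a number proportional to its length over \<open>h\<close>, and the short turns all lie in
one such ball (\<open>emeasure_thickened_spiral\<close>); \<open>summable_spiral_radius\<close> makes the sum finite.
A set and its translate by \<open>z\<close> differ only within \<open>norm z\<close> of the frontier, whence the modulus
of continuity (\<open>nn_integral_translation_difference\<close>).

The kernels of positive index have mean zero and first moment proportional to \<open>1 / 2 ^ j\<close>, so
the \<open>L\<^sup>1\<close> norms of the blocks decay like \<open>1 / 2 ^ j\<close> (\<open>nn_integral_conv_indicator_le_moment\<close>), while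
their supremum norms stay bounded; \<open>indicator_in_besov_space\<close> combines these for every bounded set
with a frontier of finite content, in any dimension.
\<close>

section \<open>Affine substitutions and Schwartz functions\<close>

lemma nn_integral_affine:
  fixes f :: "'a::euclidean_space \<Rightarrow> ennreal"
  assumes [measurable]: "f \<in> borel_measurable borel" and c: "c \<noteq> 0"
  shows "(\<integral>\<^sup>+x. f x \<partial>lborel) = ennreal (\<bar>c\<bar> ^ DIM('a)) * (\<integral>\<^sup>+x. f (t + c *\<^sub>R x) \<partial>lborel)"
  by (subst lborel_affine[OF c, of t])
     (simp add: nn_integral_density nn_integral_distr nn_integral_cmult)

lemma nn_integral_reflect:
  fixes f :: "'a::euclidean_space \<Rightarrow> ennreal"
  assumes "f \<in> borel_measurable borel"
  shows "(\<integral>\<^sup>+y. f (x - y) \<partial>lborel) = (\<integral>\<^sup>+y. f y \<partial>lborel)"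
  using nn_integral_affine[OF assms, of "-1" x] by simp

lemma integral_affine:
  fixes f :: "'a::euclidean_space \<Rightarrow> complex"
  assumes [measurable]: "f \<in> borel_measurable borel" and c: "c \<noteq> 0"
  shows "(LINT x|lborel. f x) = \<bar>c\<bar> ^ DIM('a) *\<^sub>R (LINT x|lborel. f (t + c *\<^sub>R x))"
  by (subst lborel_affine[OF c, of t])
     (simp add: integral_density integral_distr)

text \<open>The integrand is dominated by a sum over balls of integer radius,
whose volumes grow like \<open>n ^ DIM('a)\<close>, so the two extra powers leave a convergent
\<open>\<Sum> 1 / n\<^sup>2\<close>.\<close>

lemma nn_integral_inverse_power_finite:
  "(\<integral>\<^sup>+(x::'a::euclidean_space). ennreal (1 / (1 + norm x) ^ (DIM('a) + 2)) \<partial>lborel) < \<infinity>"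
proof -
  let ?N = "DIM('a) + 2"
  let ?V = "unit_ball_vol (real DIM('a))"
  \<comment> \<open>the summand with index the integer part of the norm already suffices\<close>
  have le: "ennreal (1 / (1 + norm x) ^ ?N)
      \<le> (\<Sum>n. ennreal (1 / (1 + real n) ^ ?N) * indicator (ball 0 (1 + real n)) x)" for x :: 'a
  proof -
    let ?n = "nat \<lfloor>norm x\<rfloor>"
    have n: "real ?n \<le> norm x" "norm x < 1 + real ?n" using norm_ge_zero[of x] by linarith+
    have "ennreal (1 / (1 + norm x) ^ ?N) \<le> ennreal (1 / (1 + real ?n) ^ ?N)"
      using n by (intro ennreal_leI divide_left_mono power_mono mult_pos_pos zero_less_power)
        (auto simp: add_pos_nonneg)
    also have "\<dots> = (\<Sum>n\<in>{?n}. ennreal (1 / (1 + real n) ^ ?N) * indicator (ball 0 (1 + real n)) x)"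
      using n by simp
    also have "\<dots> \<le> (\<Sum>n. ennreal (1 / (1 + real n) ^ ?N) * indicator (ball 0 (1 + real n)) x)"
      by (intro sum_le_suminf) auto
    finally show ?thesis .
  qed
  have summ: "summable (\<lambda>n. ?V * (1 / (1 + real n) ^ 2))"
    using inverse_power_summable[of 2, where 'a=real]
      summable_Suc_iff[of "\<lambda>n. inverse (real n ^ 2)"]
    by (intro summable_mult) (simp add: inverse_eq_divide)
  have "(\<integral>\<^sup>+(x::'a). ennreal (1 / (1 + norm x) ^ ?N) \<partial>lborel)
      \<le> (\<integral>\<^sup>+(x::'a). (\<Sum>n. ennreal (1 / (1 + real n) ^ ?N) * indicator (ball 0 (1 + real n)) x) \<partial>lborel)"
    by (intro nn_integral_mono le)
  also have "\<dots> = (\<Sum>n. ennreal (1 / (1 + real n) ^ ?N) * emeasure lborel (ball (0::'a) (1 + real n)))"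
    by (subst nn_integral_suminf)
       (auto intro!: borel_measurable_times_ennreal borel_measurable_indicator
             simp: nn_integral_cmult_indicator simp del: power_Suc power_add_numeral)
  also have "\<dots> = (\<Sum>n. ennreal (?V * (1 / (1 + real n) ^ 2)))"
    by (intro suminf_cong)
       (simp add: emeasure_ball ennreal_mult'[symmetric] power_add power2_eq_square divide_simps)
  also have "\<dots> = ennreal (\<Sum>n. ?V * (1 / (1 + real n) ^ 2))"
    by (rule suminf_ennreal2[OF _ summ]) simp
  finally show ?thesis by (simp add: le_less_trans)
qed

lemma schwartz_decay:
  assumes "f \<in> schwartz_space"
  obtains C where "C \<ge> 0" "\<And>x. norm (f x) \<le> C / (1 + norm x) ^ N"
proof -
  have "bounded (range (\<lambda>x. (1 + norm x) ^ N *\<^sub>R iter_partial_deriv [] f x))"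
    using assms unfolding schwartz_space_def by blast
  then obtain C where C: "\<And>x. norm ((1 + norm x) ^ N *\<^sub>R f x) \<le> C"
    unfolding bounded_iff iter_partial_deriv_def by auto
  show ?thesis
  proof
    show "norm (f x) \<le> C / (1 + norm x) ^ N" for x
      using C[of x] by (simp add: field_simps add_pos_nonneg)
    show "C \<ge> 0" using C[of 0] by (rule order_trans[OF norm_ge_zero])
  qed
qed

lemma schwartz_continuous:
  assumes "f \<in> schwartz_space"
  shows "continuous_on UNIV f"
proof -
  have "\<forall>x. iter_partial_deriv [] f differentiable (at x)"
    using assms unfolding schwartz_space_def smooth_fun_def by blast
  then show ?thesis
    unfolding iter_partial_deriv_def
    by (simp add: differentiable_imp_continuous_on differentiable_on_def)
qed

lemma schwartz_measurable:
  "f \<in> schwartz_space \<Longrightarrow> f \<in> borel_measurable borel"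
  by (intro borel_measurable_continuous_onI schwartz_continuous)

lemma schwartz_first_moment_finite:
  fixes f :: "'a::euclidean_space \<Rightarrow> complex"
  assumes "f \<in> schwartz_space"
  shows "(\<integral>\<^sup>+x. ennreal (norm (f x) * (1 + norm x)) \<partial>lborel) < \<infinity>"
proof -
  let ?N = "DIM('a) + 2"
  obtain C where C: "C \<ge> 0" "\<And>x. norm (f x) \<le> C / (1 + norm x) ^ Suc ?N"
    using schwartz_decay[OF assms] by blast
  have "norm (f x) * (1 + norm x) \<le> C * (1 / (1 + norm x) ^ ?N)" for x
    using C(2)[of x] by (simp add: field_simps add_pos_nonneg)
  then have "(\<integral>\<^sup>+x. ennreal (norm (f x) * (1 + norm x)) \<partial>lborel)
      \<le> (\<integral>\<^sup>+(x::'a). ennreal C * ennreal (1 / (1 + norm x) ^ ?N) \<partial>lborel)"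
    using C(1) by (intro nn_integral_mono) (simp add: ennreal_mult'[symmetric] ennreal_leI)
  also have "\<dots> < \<infinity>"
    using nn_integral_inverse_power_finite[where 'a='a]
    by (simp add: nn_integral_cmult ennreal_mult_less_top)
  finally show ?thesis .
qed

lemma schwartz_integrable:
  fixes f :: "'a::euclidean_space \<Rightarrow> complex"
  assumes "f \<in> schwartz_space"
  shows "integrable lborel f"
proof (rule integrableI_bounded)
  show "f \<in> borel_measurable lborel" using schwartz_measurable[OF assms] by simp
  have "(\<integral>\<^sup>+x. ennreal (norm (f x)) \<partial>lborel)
      \<le> (\<integral>\<^sup>+x. ennreal (norm (f x) * (1 + norm x)) \<partial>lborel)"
    by (intro nn_integral_mono ennreal_leI) (simp add: mult_le_cancel_left1)
  also have "\<dots> < \<infinity>" by (rule schwartz_first_moment_finite[OF assms])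
  finally show "(\<integral>\<^sup>+x. ennreal (norm (f x)) \<partial>lborel) < \<infinity>" .
qed

text \<open>Since \<^term>\<open>conv_distribution\<close> evaluates a distribution at \<open>y \<mapsto> \<phi> (x - y)\<close>, and a distribution carries
no information outside the Schwartz space, that space has to be shown invariant under affine
substitutions; the chain rule only contributes powers of the dilation factor.\<close>

lemma iter_partial_deriv_affine:
  fixes f :: "'a::euclidean_space \<Rightarrow> complex"
  assumes "smooth_fun f" "bs \<in> lists Basis"
  shows "iter_partial_deriv bs (\<lambda>y. a * f (v + c *\<^sub>R y)) =
    (\<lambda>y. a * of_real c ^ length bs * iter_partial_deriv bs f (v + c *\<^sub>R y))"
  using assms(2)
proof (induction bs)
  case Nil
  then show ?case by (simp add: iter_partial_deriv_def)
next
  case (Cons b bs)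
  let ?F = "iter_partial_deriv bs f"
  let ?k = "a * of_real c ^ length bs"
  have bs: "bs \<in> lists Basis" using Cons by blast
  have IH: "iter_partial_deriv bs (\<lambda>y. a * f (v + c *\<^sub>R y)) = (\<lambda>y. ?k * ?F (v + c *\<^sub>R y))"
    using Cons by simp
  have "frechet_derivative (\<lambda>y. ?k * ?F (v + c *\<^sub>R y)) (at y) b
      = ?k * of_real c * frechet_derivative ?F (at (v + c *\<^sub>R y)) b" for y
  proof -
    let ?D = "frechet_derivative ?F (at (v + c *\<^sub>R y))"
    have F: "(?F has_derivative ?D) (at (v + c *\<^sub>R y))"
      using assms(1) bs unfolding smooth_fun_def frechet_derivative_works[symmetric] by blast
    have "((\<lambda>y. v + c *\<^sub>R y) has_derivative (\<lambda>h. c *\<^sub>R h)) (at y)"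
      by (auto intro!: derivative_eq_intros)
    from diff_chain_at[OF this F] have "((\<lambda>y. ?F (v + c *\<^sub>R y)) has_derivative (\<lambda>h. ?D (c *\<^sub>R h))) (at y)"
      by (simp add: o_def)
    then have "((\<lambda>y. ?k * ?F (v + c *\<^sub>R y)) has_derivative (\<lambda>h. ?k * ?D (c *\<^sub>R h))) (at y)"
      by (rule has_derivative_mult_right)
    from frechet_derivative_at[OF this] have "frechet_derivative (\<lambda>y. ?k * ?F (v + c *\<^sub>R y)) (at y) b = ?k * ?D (c *\<^sub>R b)"
      by metis
    also have "?D (c *\<^sub>R b) = of_real c * ?D b"
      using has_derivative_linear[OF F] by (simp add: linear_scale scaleR_conv_of_real)
    finally show ?thesis by (simp add: algebra_simps)
  qed
  then show ?case
    using IH unfolding iter_partial_deriv_def partial_deriv_def by (simp add: mult_ac)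
qed

lemma schwartz_affine:
  fixes f :: "'a::euclidean_space \<Rightarrow> complex"
  assumes f: "f \<in> schwartz_space" and c: "c \<noteq> 0"
  shows "(\<lambda>y. a * f (v + c *\<^sub>R y)) \<in> schwartz_space"
proof -
  have sm: "smooth_fun f" using f by (simp add: schwartz_space_def)
  have "smooth_fun (\<lambda>y. a * f (v + c *\<^sub>R y))"
    unfolding smooth_fun_def
  proof (intro ballI allI)
    fix bs :: "'a list" and x assume bs: "bs \<in> lists Basis"
    have "(iter_partial_deriv bs f \<circ> (\<lambda>y. v + c *\<^sub>R y)) differentiable (at x)"
      using sm bs by (intro differentiable_chain_at) (auto simp: smooth_fun_def)
    then show "iter_partial_deriv bs (\<lambda>y. a * f (v + c *\<^sub>R y)) differentiable (at x)"
      unfolding iter_partial_deriv_affine[OF sm bs] o_def by (intro differentiable_mult) auto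
  qed
  moreover have "bounded (range (\<lambda>x. (1 + norm x) ^ N *\<^sub>R iter_partial_deriv bs (\<lambda>y. a * f (v + c *\<^sub>R y)) x))"
    if bs: "bs \<in> lists Basis" for N bs
  proof -
    let ?F = "iter_partial_deriv bs f"
    let ?k = "a * of_real c ^ length bs"
    have "bounded (range (\<lambda>x. (1 + norm x) ^ N *\<^sub>R ?F x))"
      using f bs unfolding schwartz_space_def by blast
    then obtain B where B: "\<And>x. norm ((1 + norm x) ^ N *\<^sub>R ?F x) \<le> B"
      unfolding bounded_iff by auto
    \<comment> \<open>\<open>M\<close> compares the weights at \<open>x\<close> and at the image point \<open>v + c x\<close>\<close>
    define M where "M = 1 + (1 + norm v) / \<bar>c\<bar>"
    have M: "1 + norm x \<le> M * (1 + norm (v + c *\<^sub>R x))" for x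
    proof -
      have "\<bar>c\<bar> * norm x \<le> norm (v + c *\<^sub>R x) + norm v"
        using norm_triangle_ineq4[of "v + c *\<^sub>R x" v] by simp
      then have "norm x \<le> (norm (v + c *\<^sub>R x) + norm v) / \<bar>c\<bar>"
        using c by (simp add: field_simps)
      also have "\<dots> \<le> ((1 + norm v) * (1 + norm (v + c *\<^sub>R x))) / \<bar>c\<bar>"
        by (intro divide_right_mono) (auto simp: algebra_simps)
      finally have "norm x \<le> (1 + norm v) / \<bar>c\<bar> * (1 + norm (v + c *\<^sub>R x))" by simp
      then show ?thesis 
        unfolding M_def distrib_right mult_1_left
        using norm_ge_zero[of "v + c *\<^sub>R x"] by linarith
    qed
    have M0: "M \<ge> 0" unfolding M_def by simp
    have "norm ((1 + norm x) ^ N *\<^sub>R (?k * ?F (v + c *\<^sub>R x))) \<le> norm ?k * M ^ N * B" for x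
    proof -
      have "(1 + norm x) ^ N \<le> (M * (1 + norm (v + c *\<^sub>R x))) ^ N"
        by (intro power_mono M) simp
      then have "norm ((1 + norm x) ^ N *\<^sub>R (?k * ?F (v + c *\<^sub>R x)))
          \<le> (M * (1 + norm (v + c *\<^sub>R x))) ^ N * (norm ?k * norm (?F (v + c *\<^sub>R x)))"
        by (simp add: norm_mult mult_right_mono)
      also have "\<dots> = (norm ?k * M ^ N) * norm ((1 + norm (v + c *\<^sub>R x)) ^ N *\<^sub>R ?F (v + c *\<^sub>R x))"
        by (simp add: power_mult_distrib)
      also have "\<dots> \<le> (norm ?k * M ^ N) * B"
        using M0 by (intro mult_left_mono B) simp
      finally show ?thesis .
    qed
    then show ?thesis
      unfolding iter_partial_deriv_affine[OF sm bs] bounded_iff by blast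
  qed
  ultimately show ?thesis unfolding schwartz_space_def by blast
qed

lemma iter_partial_deriv_lincomb:
  fixes f g :: "'a::euclidean_space \<Rightarrow> complex"
  assumes "smooth_fun f" "smooth_fun g" "bs \<in> lists Basis"
  shows "iter_partial_deriv bs (\<lambda>y. a * f y + b * g y) =
    (\<lambda>y. a * iter_partial_deriv bs f y + b * iter_partial_deriv bs g y)"
  using assms(3)
proof induction
  case Nil
  then show ?case by (simp add: iter_partial_deriv_def)
next
  case (Cons e bs)
  let ?F = "iter_partial_deriv bs f" and ?G = "iter_partial_deriv bs g"
  have "frechet_derivative (\<lambda>y. a * ?F y + b * ?G y) (at y) e
      = a * frechet_derivative ?F (at y) e + b * frechet_derivative ?G (at y) e" for y
  proof -
    let ?D = "\<lambda>h. a * frechet_derivative ?F (at y) h + b * frechet_derivative ?G (at y) h"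
    have "(?F has_derivative frechet_derivative ?F (at y)) (at y)"
      "(?G has_derivative frechet_derivative ?G (at y)) (at y)"
      using assms(1,2) Cons.hyps unfolding smooth_fun_def frechet_derivative_works[symmetric]
      by blast+
    then have "((\<lambda>y. a * ?F y + b * ?G y) has_derivative ?D) (at y)"
      by (intro has_derivative_add has_derivative_mult_right)
    from frechet_derivative_at[OF this] show ?thesis by metis
  qed
  then show ?case
    using Cons.IH unfolding iter_partial_deriv_def partial_deriv_def by simp
qed

lemma schwartz_lincomb:
  fixes f g :: "'a::euclidean_space \<Rightarrow> complex"
  assumes f: "f \<in> schwartz_space" and g: "g \<in> schwartz_space"
  shows "(\<lambda>y. a * f y + b * g y) \<in> schwartz_space"
proof -
  have sm: "smooth_fun f" "smooth_fun g" using f g by (simp_all add: schwartz_space_def)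
  have "smooth_fun (\<lambda>y. a * f y + b * g y)"
    unfolding smooth_fun_def
  proof (intro ballI allI)
    fix bs :: "'a list" and x assume bs: "bs \<in> lists Basis"
    then show "iter_partial_deriv bs (\<lambda>y. a * f y + b * g y) differentiable (at x)"
      using sm unfolding iter_partial_deriv_lincomb[OF sm bs] smooth_fun_def
      by (intro differentiable_add differentiable_mult) auto
  qed
  moreover have "bounded (range (\<lambda>x. (1 + norm x) ^ N *\<^sub>R iter_partial_deriv bs (\<lambda>y. a * f y + b * g y) x))"
    if bs: "bs \<in> lists Basis" for N bs
  proof -
    let ?F = "\<lambda>x. (1 + norm x) ^ N *\<^sub>R iter_partial_deriv bs f x"
    let ?G = "\<lambda>x. (1 + norm x) ^ N *\<^sub>R iter_partial_deriv bs g x"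
    have "bounded (range ?F)" "bounded (range ?G)"
      using f g bs unfolding schwartz_space_def by blast+
    then obtain K L where KL: "\<And>x. norm (?F x) \<le> K" "\<And>x. norm (?G x) \<le> L"
      unfolding bounded_iff by auto
    have "norm (a * ?F x + b * ?G x) \<le> norm a * K + norm b * L" for x
      by (rule order_trans[OF norm_triangle_ineq])
         (simp only: norm_mult, intro add_mono mult_left_mono KL norm_ge_zero)
    then show ?thesis
      unfolding iter_partial_deriv_lincomb[OF sm bs] bounded_iff
      by (auto simp: scaleR_add_right)
  qed
  ultimately show ?thesis unfolding schwartz_space_def by blast
qed

lemma schwartz_norm_le_seminorm:
  assumes "f \<in> schwartz_space"
  shows "norm (f x) \<le> schwartz_seminorm 0 f"
proof -
  obtain C where "\<And>x. norm (f x) \<le> C"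
    using schwartz_decay[OF assms, of 0] by auto
  then have "bdd_above ((\<lambda>(bs, x). (1 + norm x) ^ 0 * norm (iter_partial_deriv bs f x)) `
      ({bs \<in> lists Basis. length bs \<le> 0} \<times> UNIV))"
    by (intro bdd_aboveI[of _ C]) (auto simp: iter_partial_deriv_def)
  from cSUP_upper[OF _ this, of "([], x)"] show ?thesis
    unfolding schwartz_seminorm_def by (simp add: iter_partial_deriv_def)
qed

section \<open>Translates of sets with a thin frontier\<close>

lemma norm_integral_le_nn_integral:
  fixes f :: "'a \<Rightarrow> complex"
  shows "ennreal (norm (LINT x|M. f x)) \<le> (\<integral>\<^sup>+x. ennreal (norm (f x)) \<partial>M)"
  by (cases "integrable M f") (simp_all add: integral_norm_bound_ennreal not_integrable_integral_eq)

text \<open>The translate of a set differs from the set only near the frontier: the segment from \<open>x\<close> to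
\<open>x - z\<close> joins a point inside to a point outside, so it crosses the frontier within distance
\<open>norm z\<close> of \<open>x\<close>.\<close>

lemma segment_meets_frontier:
  fixes U :: "'a::euclidean_space set"
  assumes "(x \<in> U) \<noteq> (x - z \<in> U)"
  obtains w where "w \<in> frontier U" "dist w x \<le> norm z"
proof -
  have "closed_segment x (x - z) \<inter> frontier U \<noteq> {}"
    using assms by (intro connected_Int_frontier) auto
  then obtain w where w: "w \<in> closed_segment x (x - z)" "w \<in> frontier U" by blast
  have "dist w x \<le> norm z"
    using dist_in_closed_segment[OF w(1)] by (simp add: dist_norm norm_minus_commute)
  with w(2) show ?thesis by (rule that)
qed

text \<open>The \<open>L\<^sup>1\<close> modulus of continuity of an indicator is linear as soon as the frontier has finite
upper Minkowski content of codimension one. For short \<open>z\<close> the difference lives in a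
neighbourhood of the frontier; for long \<open>z\<close> the trivial bound by twice the measure is already
linear in \<open>norm z\<close>. The balls of the hypothesis are open whereas the crossing point may lie
at distance exactly \<open>norm z\<close>, so radius \<open>2 * norm z\<close> is used, which explains
the threshold \<open>1/2\<close> and the constant.\<close>

lemma nn_integral_translation_difference:
  fixes U :: "'a::euclidean_space set"
  assumes U: "open U" and m: "emeasure lborel U \<le> ennreal m" "m \<ge> 0" and C: "C \<ge> 0"
    and content: "\<And>h. 0 < h \<Longrightarrow> h \<le> 1 \<Longrightarrow>
      emeasure lborel (\<Union>w\<in>frontier U. ball w h) \<le> ennreal (C * h)"
  shows "(\<integral>\<^sup>+x. ennreal \<bar>indicator U (x - z) - indicator U x\<bar> \<partial>lborel)
    \<le> ennreal ((2 * C + 4 * m) * norm z)"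
proof (cases "norm z \<le> 1 / 2")
  case True
  show ?thesis
  proof (cases "z = 0")
    case False
    let ?N = "\<Union>w\<in>frontier U. ball w (2 * norm z)"
    have "ennreal \<bar>indicator U (x - z) - indicator U x\<bar> \<le> indicator ?N x" for x
    proof (cases "(x \<in> U) = (x - z \<in> U)")
      case True
      then show ?thesis by (auto simp: indicator_def)
    next
      case ne: False
      then obtain w where "w \<in> frontier U" "dist w x \<le> norm z" by (rule segment_meets_frontier)
      moreover have "norm z < 2 * norm z" using False by simp
      ultimately have "x \<in> ?N" by (meson UN_I le_less_trans mem_ball)
      then show ?thesis by (auto simp: indicator_def)
    qed
    then have "(\<integral>\<^sup>+x. ennreal \<bar>indicator U (x - z) - indicator U x\<bar> \<partial>lborel)
        \<le> (\<integral>\<^sup>+x. indicator ?N x \<partial>lborel)"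
      by (intro nn_integral_mono)
    also have "\<dots> = emeasure lborel ?N" by (subst nn_integral_indicator) (auto intro!: borel_open)
    also have "\<dots> \<le> ennreal (C * (2 * norm z))" using False True by (intro content) auto
    also have "\<dots> \<le> ennreal ((2 * C + 4 * m) * norm z)"
      using m by (intro ennreal_leI) (simp add: algebra_simps)
    finally show ?thesis .
  qed simp
next
  case False
  have [measurable]: "U \<in> sets borel" using U by simp
  have tr: "(\<integral>\<^sup>+x. indicator U (x - z) \<partial>lborel) = emeasure lborel U"
    using nn_integral_affine[of "indicator U" 1 "-z"] by simp
  have "(\<integral>\<^sup>+x. ennreal \<bar>indicator U (x - z) - indicator U x\<bar> \<partial>lborel)
      \<le> (\<integral>\<^sup>+x. indicator U (x - z) + indicator U x \<partial>lborel)"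
    by (intro nn_integral_mono) (auto simp: indicator_def)
  also have "\<dots> = emeasure lborel U + emeasure lborel U"
    by (simp add: nn_integral_add tr)
  also have "\<dots> \<le> ennreal m + ennreal m" by (intro add_mono m)
  also have "\<dots> \<le> ennreal ((2 * C + 4 * m) * norm z)"
  proof -
    have "m * 1 \<le> m * (2 * norm z)" using False m by (intro mult_left_mono) auto
    moreover have "0 \<le> C * norm z" using C by simp
    ultimately have "m + m \<le> (2 * C + 4 * m) * norm z" by (simp add: algebra_simps)
    then show ?thesis using m by (simp add: ennreal_plus[symmetric] ennreal_leI del: ennreal_plus)
  qed
  finally show ?thesis .
qed

section \<open>Convolution of a kernel with an indicator\<close>

text \<open>Size of the convolution of a kernel \<open>\<psi>\<close> with an indicator. The trivial bounds serve for the
supremum norm and for the low frequency block; the gain \<open>2\<^sup>-\<^sup>j\<close> in the other blocks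
comes from the vanishing mean.\<close>

context
  fixes U :: "'a::euclidean_space set" and \<psi> :: "'a \<Rightarrow> complex"
  assumes U[measurable]: "U \<in> sets borel" and \<psi>_measurable[measurable]: "\<psi> \<in> borel_measurable borel"
begin

lemma conv_indicator_measurable:
  "(\<lambda>x. LINT y|lborel. indicator U y * \<psi> (x - y)) \<in> borel_measurable borel"
  by measurable

lemma norm_conv_indicator_le:
  assumes "(\<integral>\<^sup>+x. ennreal (norm (\<psi> x)) \<partial>lborel) \<le> ennreal A" "A \<ge> 0"
  shows "norm (LINT y|lborel. indicator U y * \<psi> (x - y)) \<le> A"
proof -
  have "ennreal (norm (LINT y|lborel. indicator U y * \<psi> (x - y)))
      \<le> (\<integral>\<^sup>+y. ennreal (norm (indicator U y * \<psi> (x - y))) \<partial>lborel)"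
    by (rule norm_integral_le_nn_integral)
  also have "\<dots> \<le> (\<integral>\<^sup>+y. ennreal (norm (\<psi> (x - y))) \<partial>lborel)"
    by (intro nn_integral_mono ennreal_leI) (auto simp: indicator_def)
  also have "\<dots> = (\<integral>\<^sup>+y. ennreal (norm (\<psi> y)) \<partial>lborel)"
    by (rule nn_integral_reflect) measurable
  also have "\<dots> \<le> ennreal A" by (rule assms)
  finally show ?thesis using assms(2) by simp
qed

lemma nn_integral_conv_indicator_le_measure:
  assumes "(\<integral>\<^sup>+x. ennreal (norm (\<psi> x)) \<partial>lborel) \<le> ennreal A"
    and "emeasure lborel U \<le> ennreal m" "A \<ge> 0"
  shows "(\<integral>\<^sup>+x. ennreal (norm (LINT y|lborel. indicator U y * \<psi> (x - y))) \<partial>lborel) \<le> ennreal (A * m)"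
proof -
  have "(\<integral>\<^sup>+x. ennreal (norm (LINT y|lborel. indicator U y * \<psi> (x - y))) \<partial>lborel)
      \<le> (\<integral>\<^sup>+x. \<integral>\<^sup>+y. indicator U y * ennreal (norm (\<psi> (x - y))) \<partial>lborel \<partial>lborel)"
    by (intro nn_integral_mono order_trans[OF norm_integral_le_nn_integral])
       (auto simp: indicator_def)
  also have "\<dots> = (\<integral>\<^sup>+y. \<integral>\<^sup>+x. indicator U y * ennreal (norm (\<psi> (x - y))) \<partial>lborel \<partial>lborel)"
    by (rule lborel_pair.Fubini') measurable
  also have "\<dots> = (\<integral>\<^sup>+y. (\<integral>\<^sup>+x. ennreal (norm (\<psi> x)) \<partial>lborel) * indicator U y \<partial>lborel)"
  proof (rule nn_integral_cong)
    fix y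
    have "(\<integral>\<^sup>+x. ennreal (norm (\<psi> (x - y))) \<partial>lborel) = (\<integral>\<^sup>+x. ennreal (norm (\<psi> x)) \<partial>lborel)"
      using nn_integral_affine[of "\<lambda>x. ennreal (norm (\<psi> x))" 1 "-y"] by simp
    then show "(\<integral>\<^sup>+x. indicator U y * ennreal (norm (\<psi> (x - y))) \<partial>lborel)
        = (\<integral>\<^sup>+x. ennreal (norm (\<psi> x)) \<partial>lborel) * indicator U y"
      by (simp add: nn_integral_cmult mult.commute)
  qed
  also have "\<dots> = (\<integral>\<^sup>+x. ennreal (norm (\<psi> x)) \<partial>lborel) * emeasure lborel U"
    by (simp add: nn_integral_cmult_indicator)
  also have "\<dots> \<le> ennreal A * ennreal m" by (intro mult_mono assms) auto
  finally show ?thesis using assms(3) by (simp add: ennreal_mult')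
qed

text \<open>Because \<open>\<psi>\<close> has mean zero, the indicator may be replaced under the integral by its difference
with the value at \<open>x\<close>. Tonelli then leaves the \<open>L\<^sup>1\<close> modulus of continuity, which
costs one factor \<open>norm z\<close>, against \<open>\<psi>\<close>.\<close>

lemma nn_integral_conv_indicator_le_moment:
  assumes \<psi>: "integrable lborel \<psi>" and mean: "(LINT x|lborel. \<psi> x) = 0"
    and moment: "(\<integral>\<^sup>+x. ennreal (norm (\<psi> x) * norm x) \<partial>lborel) \<le> ennreal M"
    and diff: "\<And>z. (\<integral>\<^sup>+x. ennreal \<bar>indicator U (x - z) - indicator U x\<bar> \<partial>lborel) \<le> ennreal (K * norm z)"
    and K: "K \<ge> 0"
  shows "(\<integral>\<^sup>+x. ennreal (norm (LINT y|lborel. indicator U y * \<psi> (x - y))) \<partial>lborel) \<le> ennreal (K * M)"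
proof -
  let ?d = "\<lambda>x y. indicator U y - indicator U x :: real"
  have "ennreal (norm (LINT y|lborel. indicator U y * \<psi> (x - y)))
      \<le> (\<integral>\<^sup>+z. ennreal (norm (\<psi> z)) * ennreal \<bar>?d x (x - z)\<bar> \<partial>lborel)" for x
  proof -
    have refl_int: "integrable lborel (\<lambda>y. \<psi> (x - y))"
    proof (rule integrableI_bounded)
      have "(\<integral>\<^sup>+y. ennreal (norm (\<psi> (x - y))) \<partial>lborel) = (\<integral>\<^sup>+y. ennreal (norm (\<psi> y)) \<partial>lborel)"
        by (rule nn_integral_reflect) measurable
      then show "(\<integral>\<^sup>+y. ennreal (norm (\<psi> (x - y))) \<partial>lborel) < \<infinity>"
        using \<psi> by (simp add: integrable_iff_bounded)
    qed measurable
    have refl0: "(LINT y|lborel. \<psi> (x - y)) = 0"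
      using integral_affine[OF \<psi>_measurable, of "-1" x] mean by simp
    have int1: "integrable lborel (\<lambda>y. indicator U y * \<psi> (x - y))"
      by (rule Bochner_Integration.integrable_bound[OF refl_int]) (measurable, auto simp: indicator_def)
    have "(LINT y|lborel. indicator U y * \<psi> (x - y))
        = (LINT y|lborel. indicator U y * \<psi> (x - y)) - indicator U x * (LINT y|lborel. \<psi> (x - y))"
      by (simp add: refl0)
    also have "\<dots> = (LINT y|lborel. indicator U y * \<psi> (x - y) - indicator U x * \<psi> (x - y))"
      using int1 refl_int by simp
    also have "\<dots> = (LINT y|lborel. of_real (?d x y) * \<psi> (x - y))"
      by (intro Bochner_Integration.integral_cong refl) (auto simp: indicator_def)
    finally have "ennreal (norm (LINT y|lborel. indicator U y * \<psi> (x - y)))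
        \<le> (\<integral>\<^sup>+y. ennreal (norm (of_real (?d x y) * \<psi> (x - y))) \<partial>lborel)"
      using norm_integral_le_nn_integral[of lborel "\<lambda>y. of_real (?d x y) * \<psi> (x - y)"] by simp
    also have "\<dots> = (\<integral>\<^sup>+y. ennreal (norm (\<psi> (x - y))) * ennreal \<bar>?d x (x - (x - y))\<bar> \<partial>lborel)"
      by (intro nn_integral_cong)
         (simp only: norm_mult norm_of_real ennreal_mult' abs_ge_zero diff_diff_cancel
           diff_diff_eq2 add_diff_cancel_left' norm_ge_zero mult.commute[of "\<bar>_\<bar>"])
    also have "\<dots> = (\<integral>\<^sup>+z. ennreal (norm (\<psi> z)) * ennreal \<bar>?d x (x - z)\<bar> \<partial>lborel)"
      by (rule nn_integral_reflect[where f="\<lambda>z. ennreal (norm (\<psi> z)) * ennreal \<bar>?d x (x - z)\<bar>"]) measurable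
    finally show ?thesis .
  qed
  then have "(\<integral>\<^sup>+x. ennreal (norm (LINT y|lborel. indicator U y * \<psi> (x - y))) \<partial>lborel)
      \<le> (\<integral>\<^sup>+x. \<integral>\<^sup>+z. ennreal (norm (\<psi> z)) * ennreal \<bar>?d x (x - z)\<bar> \<partial>lborel \<partial>lborel)"
    by (intro nn_integral_mono)
  also have "\<dots> = (\<integral>\<^sup>+z. \<integral>\<^sup>+x. ennreal (norm (\<psi> z)) * ennreal \<bar>?d x (x - z)\<bar> \<partial>lborel \<partial>lborel)"
    by (rule lborel_pair.Fubini') measurable
  also have "\<dots> = (\<integral>\<^sup>+z. ennreal (norm (\<psi> z)) * (\<integral>\<^sup>+x. ennreal \<bar>?d x (x - z)\<bar> \<partial>lborel) \<partial>lborel)"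
    by (intro nn_integral_cong nn_integral_cmult) measurable
  also have "\<dots> \<le> (\<integral>\<^sup>+z. ennreal (norm (\<psi> z)) * ennreal (K * norm z) \<partial>lborel)"
    by (intro nn_integral_mono mult_left_mono diff) auto
  also have "\<dots> = (\<integral>\<^sup>+z. ennreal K * ennreal (norm (\<psi> z) * norm z) \<partial>lborel)"
    using K by (intro nn_integral_cong) (simp add: ennreal_mult'[symmetric] mult_ac)
  also have "\<dots> = ennreal K * (\<integral>\<^sup>+z. ennreal (norm (\<psi> z) * norm z) \<partial>lborel)"
    by (rule nn_integral_cmult) measurable
  also have "\<dots> \<le> ennreal K * ennreal M" by (intro mult_left_mono moment) auto
  finally show ?thesis using K by (simp add: ennreal_mult')
qed

end

text \<open>With \<open>s = 1/p\<close> this is \<open>\<parallel>f\<parallel>\<^sub>p \<le> \<parallel>f\<parallel>\<^sub>\<infinity> powr (1 - s) * \<parallel>f\<parallel>\<^sub>1 powr s\<close>, from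
\<open>\<bar>f\<bar> powr p \<le> A powr (p - 1) * \<bar>f\<bar>\<close>. It is what turns the smoothness \<open>1\<close> in \<open>L\<^sup>1\<close> into
smoothness \<open>1/p\<close> in \<open>L\<^sup>p\<close>. Here \<open>s\<close> is \<open>0\<close> when \<open>p = \<infinity>\<close>, and then the
factor \<open>D powr 0\<close> equals \<open>1\<close> because \<open>D\<close> is positive.\<close>

lemma Lp_norm_interpolation:
  fixes f :: "'a::euclidean_space \<Rightarrow> complex"
  assumes [measurable]: "f \<in> borel_measurable borel"
    and sup: "\<And>x. norm (f x) \<le> A" and A: "A > 0"
    and L1: "(\<integral>\<^sup>+x. ennreal (norm (f x)) \<partial>lborel) \<le> ennreal D" and D: "D > 0" and p: "1 \<le> p"
  defines "s \<equiv> enn2real (1 / p)"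
  shows "Lp_norm p f \<le> ennreal (A powr (1 - s) * D powr s)"
proof (cases "p = \<infinity>")
  case True
  have "esssup lebesgue (\<lambda>x. ennreal (norm (f x))) \<le> ennreal A"
  proof (rule esssup_I)
    show "(\<lambda>x. ennreal (norm (f x))) \<in> borel_measurable lebesgue"
    proof (rule measurable_completion)
      show "(\<lambda>x. ennreal (norm (f x))) \<in> borel_measurable lborel"
        by measurable
    qed
    show "AE x in lebesgue. ennreal (norm (f x)) \<le> ennreal A"
      by (rule AE_I2) (rule ennreal_leI[OF sup])
  qed
  moreover have "s = 0" using True by (simp add: s_def)
  ultimately show ?thesis using True A D by (simp add: Lp_norm_def)
next
  case False
  define q where "q = enn2real p"
  have pq: "p = ennreal q" using False by (simp add: q_def less_top)
  have q: "q \<ge> 1" using p unfolding pq by simp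
  have s: "s = 1 / q" using q unfolding s_def pq by (simp add: ennreal_1[symmetric] divide_ennreal del: ennreal_1)
  define I where "I = (\<integral>\<^sup>+x. ennreal (norm (f x) powr q) \<partial>lebesgue)"
  have "I = (\<integral>\<^sup>+x. ennreal (norm (f x) powr q) \<partial>lborel)"
    unfolding I_def by (rule nn_integral_completion)
  also have "\<dots> \<le> (\<integral>\<^sup>+x. ennreal (A powr (q - 1)) * ennreal (norm (f x)) \<partial>lborel)"
  proof (rule nn_integral_mono)
    fix x
    have "norm (f x) powr q = norm (f x) powr (q - 1) * norm (f x)"
      by (cases "f x = 0") (simp_all add: powr_diff)
    also have "\<dots> \<le> A powr (q - 1) * norm (f x)"
      using q sup by (intro mult_right_mono powr_mono2) auto
    finally show "ennreal (norm (f x) powr q) \<le> ennreal (A powr (q - 1)) * ennreal (norm (f x))"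
      by (simp add: ennreal_mult'[symmetric] ennreal_leI)
  qed
  also have "\<dots> = ennreal (A powr (q - 1)) * (\<integral>\<^sup>+x. ennreal (norm (f x)) \<partial>lborel)"
    by (rule nn_integral_cmult) measurable
  also have "\<dots> \<le> ennreal (A powr (q - 1)) * ennreal D" by (intro mult_left_mono L1) auto
  finally have I: "I \<le> ennreal (A powr (q - 1) * D)" by (simp add: ennreal_mult')
  then have fin: "I \<noteq> \<infinity>" by (auto simp: top_unique)
  have "enn2real I \<le> A powr (q - 1) * D"
    using I D by (intro enn2real_leI) auto
  then have "enn2real I powr (1 / q) \<le> (A powr (q - 1) * D) powr (1 / q)"
    using q by (intro powr_mono2) auto
  also have "\<dots> = A powr ((q - 1) * (1 / q)) * D powr (1 / q)"
    using A D by (simp add: powr_mult powr_powr)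
  also have "(q - 1) * (1 / q) = 1 - s" using q by (simp add: s field_simps)
  finally have "enn2real I powr (1 / q) \<le> A powr (1 - s) * D powr s" by (simp add: s)
  then show ?thesis
    using False fin unfolding Lp_norm_def Let_def by (simp flip: I_def q_def add: ennreal_leI)
qed

section \<open>Besov regularity of indicators\<close>

lemma schwartz_reflect:
  fixes f :: "'a::euclidean_space \<Rightarrow> complex"
  assumes "f \<in> schwartz_space"
  shows "(\<lambda>y. f (x - y)) \<in> schwartz_space"
  using schwartz_affine[OF assms, of "-1" 1 x] by simp

lemma dyadic_schwartz:
  fixes \<phi>0 \<phi> :: "'a::euclidean_space \<Rightarrow> complex"
  assumes "\<phi>0 \<in> schwartz_space" "\<phi> \<in> schwartz_space"
  shows "dyadic \<phi>0 \<phi> j \<in> schwartz_space"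
  using assms(1) schwartz_affine[OF assms(2), of "2 ^ j" "2 ^ (j * DIM('a))" 0]
  by (simp add: dyadic_def)

lemma nn_integral_dyadic:
  fixes \<phi> :: "'a::euclidean_space \<Rightarrow> complex"
  assumes [measurable]: "\<phi> \<in> borel_measurable borel" and j: "j > 0"
  shows "(\<integral>\<^sup>+x. ennreal (norm (dyadic \<phi>0 \<phi> j x)) \<partial>lborel) = (\<integral>\<^sup>+x. ennreal (norm (\<phi> x)) \<partial>lborel)"
proof -
  have "(\<integral>\<^sup>+x. ennreal (norm (\<phi> x)) \<partial>lborel)
      = ennreal ((2 ^ j) ^ DIM('a)) * (\<integral>\<^sup>+x. ennreal (norm (\<phi> (2 ^ j *\<^sub>R x))) \<partial>lborel)"
    using nn_integral_affine[of "\<lambda>x. ennreal (norm (\<phi> x))" "2 ^ j" 0] by simp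
  also have "\<dots> = (\<integral>\<^sup>+x. ennreal ((2 ^ j) ^ DIM('a)) * ennreal (norm (\<phi> (2 ^ j *\<^sub>R x))) \<partial>lborel)"
    by (rule nn_integral_cmult[symmetric]) measurable
  also have "\<dots> = (\<integral>\<^sup>+x. ennreal (norm (dyadic \<phi>0 \<phi> j x)) \<partial>lborel)"
    using j by (intro nn_integral_cong)
      (simp add: dyadic_def norm_mult norm_power power_mult ennreal_mult'[symmetric])
  finally show ?thesis by simp
qed

text \<open>While dilation preserves the \<open>L\<^sup>1\<close> norm of the kernel, its mass concentrates at distances of order
\<open>1 / 2 ^ j\<close> from the origin; this is the source of the decay of the frequency blocks.\<close>

lemma nn_integral_dyadic_moment:
  fixes \<phi> :: "'a::euclidean_space \<Rightarrow> complex"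
  assumes [measurable]: "\<phi> \<in> borel_measurable borel" and j: "j > 0"
  shows "(\<integral>\<^sup>+x. ennreal (norm (dyadic \<phi>0 \<phi> j x) * norm x) \<partial>lborel)
    = ennreal (1 / 2 ^ j) * (\<integral>\<^sup>+x. ennreal (norm (\<phi> x) * norm x) \<partial>lborel)"
proof -
  let ?f = "\<lambda>x. ennreal (norm (\<phi> x) * norm x)"
  have "ennreal (1 / 2 ^ j) * (\<integral>\<^sup>+x. ?f x \<partial>lborel)
      = ennreal (1 / 2 ^ j) * (ennreal ((2 ^ j) ^ DIM('a)) * (\<integral>\<^sup>+x. ?f (2 ^ j *\<^sub>R x) \<partial>lborel))"
    using nn_integral_affine[of ?f "2 ^ j" 0] by simp
  also have "\<dots> = ennreal (1 / 2 ^ j * (2 ^ j) ^ DIM('a)) * (\<integral>\<^sup>+x. ?f (2 ^ j *\<^sub>R x) \<partial>lborel)"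
    by (simp only: mult.assoc[symmetric] ennreal_mult'[symmetric] zero_le_divide_1_iff zero_le_power zero_le_numeral)
  also have "\<dots> = (\<integral>\<^sup>+x. ennreal (1 / 2 ^ j * (2 ^ j) ^ DIM('a)) * ?f (2 ^ j *\<^sub>R x) \<partial>lborel)"
    by (rule nn_integral_cmult[symmetric]) measurable
  also have "\<dots> = (\<integral>\<^sup>+x. ennreal (norm (dyadic \<phi>0 \<phi> j x) * norm x) \<partial>lborel)"
  proof (rule nn_integral_cong)
    fix x :: 'a
    have "1 / 2 ^ j * (2 ^ j) ^ DIM('a) * (norm (\<phi> (2 ^ j *\<^sub>R x)) * norm (2 ^ j *\<^sub>R x))
        = norm (dyadic \<phi>0 \<phi> j x) * norm x"
      using j by (simp add: dyadic_def norm_mult norm_power power_mult)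
    then show "ennreal (1 / 2 ^ j * (2 ^ j) ^ DIM('a)) * ?f (2 ^ j *\<^sub>R x)
        = ennreal (norm (dyadic \<phi>0 \<phi> j x) * norm x)"
      by (subst ennreal_mult'[symmetric]) auto
  qed
  finally show ?thesis by simp
qed

text \<open>The mean is the Fourier transform at the origin, up to normalisation, and the origin lies outside
the annulus \<open>1/2 \<le> norm \<xi>\<close> that supports it.\<close>

lemma dyadic_integral_zero:
  fixes \<phi>0 \<phi> :: "'a::euclidean_space \<Rightarrow> complex"
  assumes "admissible_pair \<phi>0 \<phi>" and j: "j > 0"
  shows "(LINT x|lborel. dyadic \<phi>0 \<phi> j x) = 0"
proof -
  have \<phi>: "\<phi> \<in> schwartz_space" and supp: "fun_support (fourier_transform \<phi>) \<subseteq> {\<xi>. 1 / 2 \<le> norm \<xi> \<and> norm \<xi> \<le> 2}"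
    using assms unfolding admissible_pair_def by auto
  have [measurable]: "\<phi> \<in> borel_measurable borel" by (rule schwartz_measurable[OF \<phi>])
  have "0 \<notin> fun_support (fourier_transform \<phi>)" using supp by auto
  then have "fourier_transform \<phi> 0 = 0"
    using closure_subset[of "{\<xi>. fourier_transform \<phi> \<xi> \<noteq> 0}"] unfolding fun_support_def
    by (auto dest: subsetD)
  then have "(LINT x|lborel. \<phi> x) = 0" by (simp add: fourier_transform_def)
  then have "(LINT x|lborel. \<phi> (2 ^ j *\<^sub>R x)) = 0"
    using integral_affine[of \<phi> "2 ^ j" 0] by simp
  then show ?thesis using j by (simp add: dyadic_def)
qed

lemma interior_almost_everywhere:
  fixes E :: "'a::euclidean_space set"
  assumes "E - interior E \<subseteq> N" "N \<in> null_sets lborel"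
  shows "E \<in> sets lebesgue" "AE x in lebesgue. x \<in> E \<longleftrightarrow> x \<in> interior E"
proof -
  have N: "N \<in> null_sets lebesgue" using assms(2) by (rule null_sets_completionI)
  have "E - interior E \<in> null_sets lebesgue"
    using null_sets_completion_subset[OF assms(1) N] .
  moreover have "interior E \<in> sets lebesgue" by (simp add: lborelD)
  moreover have "E = interior E \<union> (E - interior E)" using interior_subset by blast
  ultimately show "E \<in> sets lebesgue" by (metis sets.Un null_setsD2)
  show "AE x in lebesgue. x \<in> E \<longleftrightarrow> x \<in> interior E"
    using AE_not_in[OF N]
  proof eventually_elim
    case (elim x)
    then show ?case using assms(1) interior_subset[of E] by blast
  qed
qed

text \<open>Content of codimension one forces measure zero; thus a set with such a frontier agrees almost
everywhere with its interior, which is a Borel set.\<close>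

lemma frontier_null:
  fixes F :: "'a::euclidean_space set"
  assumes F: "closed F"
    and content: "\<And>h. 0 < h \<Longrightarrow> h \<le> 1 \<Longrightarrow> emeasure lborel (\<Union>w\<in>F. ball w h) \<le> ennreal (C * h)"
  shows "F \<in> null_sets lborel"
proof -
  have "emeasure lborel F \<le> ennreal (C * h)" if "0 < h" "h \<le> 1" for h
  proof -
    have "emeasure lborel F \<le> emeasure lborel (\<Union>w\<in>F. ball w h)"
      using that by (intro emeasure_mono) (auto intro!: borel_open)
    then show ?thesis using content[OF that] by simp
  qed
  then have "\<forall>\<^sub>F h in at_right (0::real). emeasure lborel F \<le> ennreal (C * h)"
    unfolding eventually_at_right_field by (auto intro!: exI[of _ 1])
  moreover have "((\<lambda>h. ennreal (C * h)) \<longlongrightarrow> ennreal (C * 0)) (at_right 0)"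
    by (intro tendsto_ennrealI tendsto_intros)
  ultimately have "emeasure lborel F \<le> ennreal (C * 0)"
    by (intro tendsto_lowerbound) auto
  then show ?thesis using F by (auto intro!: null_setsI)
qed

text \<open>The frequency blocks are bounded
uniformly in \<open>j\<close>, their \<open>L\<^sup>1\<close> norms are \<open>O(1 / 2 ^ j)\<close>, and interpolation gives
\<open>O((1 / 2 ^ j) powr (1 / p))\<close> in \<open>L\<^sup>p\<close>. The analysis is carried out for the interior of \<open>E\<close>,
so that all integrands are Borel measurable and Tonelli applies to \<^term>\<open>lborel\<close>.\<close>

theorem indicator_in_besov_space:
  fixes E :: "'a::euclidean_space set" and \<phi>0 \<phi> :: "'a \<Rightarrow> complex"
  assumes adm: "admissible_pair \<phi>0 \<phi>" and p: "1 \<le> p"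
    and E: "bounded E" and C: "C \<ge> 0"
    and content: "\<And>h. 0 < h \<Longrightarrow> h \<le> 1 \<Longrightarrow>
      emeasure lborel (\<Union>w\<in>frontier E. ball w h) \<le> ennreal (C * h)"
  shows "\<exists>T \<in> besov_space \<phi>0 \<phi> (enn2real (1 / p)) p. generated_by T (indicator E)"
proof -
  define U where "U = interior E"
  have oU: "open U" by (simp add: U_def)
  then have U[measurable]: "U \<in> sets borel" by simp
  have frU: "frontier U \<subseteq> frontier E" unfolding U_def by (rule frontier_interior_subset)
  have contentU: "emeasure lborel (\<Union>w\<in>frontier U. ball w h) \<le> ennreal (C * h)" if "0 < h" "h \<le> 1" for h
  proof -
    have "emeasure lborel (\<Union>w\<in>frontier U. ball w h) \<le> emeasure lborel (\<Union>w\<in>frontier E. ball w h)"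
      using frU by (intro emeasure_mono) (auto intro!: borel_open)
    then show ?thesis using content[OF that] by simp
  qed
  have "E - interior E \<subseteq> frontier E" using closure_subset by (auto simp: frontier_def)
  moreover have "frontier E \<in> null_sets lborel"
    by (rule frontier_null[OF frontier_closed content])
  ultimately have Elb[measurable]: "E \<in> sets lebesgue" and EU: "AE x in lebesgue. x \<in> E \<longleftrightarrow> x \<in> U"
    unfolding U_def by (rule interior_almost_everywhere)+
  have "bounded U" using E interior_subset unfolding U_def by (rule bounded_subset)
  then have finU: "emeasure lborel U < \<infinity>" by (rule emeasure_bounded_finite)
  define m where "m = enn2real (emeasure lborel U)"
  have m: "emeasure lborel U = ennreal m" "m \<ge> 0" using finU by (simp_all add: m_def)

  define T where "T = restrict (\<lambda>g. LINT y|lborel. indicator U y * g y) schwartz_space"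
  have intU: "integrable lborel (\<lambda>y. indicator U y * g y)" if g: "g \<in> schwartz_space" for g :: "'a \<Rightarrow> complex"
    by (rule Bochner_Integration.integrable_bound[OF schwartz_integrable[OF g]])
       (use schwartz_measurable[OF g] in measurable, auto simp: indicator_def)
  have T_le: "norm (T g) \<le> m * schwartz_seminorm 0 g" if g: "g \<in> schwartz_space" for g
  proof -
    let ?S = "schwartz_seminorm 0 g"
    have S: "?S \<ge> 0" using schwartz_norm_le_seminorm[OF g, of 0] norm_ge_zero order_trans by blast
    have "ennreal (norm (T g)) \<le> (\<integral>\<^sup>+y. ennreal (norm (indicator U y * g y)) \<partial>lborel)"
      using g norm_integral_le_nn_integral by (simp add: T_def)
    also have "\<dots> \<le> (\<integral>\<^sup>+y. ennreal ?S * indicator U y \<partial>lborel)"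
      using schwartz_norm_le_seminorm[OF g] by (intro nn_integral_mono) (auto simp: indicator_def ennreal_leI)
    also have "\<dots> = ennreal (m * ?S)"
      using S m by (subst nn_integral_cmult_indicator) (simp_all add: ennreal_mult' mult.commute)
    finally show ?thesis using S m by simp
  qed
  have "T (\<lambda>x. a * f x + b * g x) = a * T f + b * T g"
    if f: "f \<in> schwartz_space" and g: "g \<in> schwartz_space" for f g a b
  proof -
    have "T (\<lambda>x. a * f x + b * g x) = (LINT y|lborel. indicator U y * (a * f y + b * g y))"
      using schwartz_lincomb[OF f g] by (simp add: T_def)
    also have "\<dots> = (LINT y|lborel. a * (indicator U y * f y) + b * (indicator U y * g y))"
      by (simp add: algebra_simps)
    also have "\<dots> = a * T f + b * T g"
      using f g intU[OF f] intU[OF g] by (simp add: T_def)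
    finally show ?thesis .
  qed
  moreover have "T \<in> extensional schwartz_space" by (simp add: T_def)
  ultimately have temp: "T \<in> tempered_distributions"
    unfolding tempered_distributions_def using T_le by blast

  have gen: "generated_by T (indicator E)"
    unfolding generated_by_def
  proof
    fix g :: "'a \<Rightarrow> complex" assume g: "g \<in> schwartz_space"
    then have [measurable]: "g \<in> borel_measurable borel" by (rule schwartz_measurable)
    have gm[measurable]: "g \<in> borel_measurable lebesgue" by (simp add: measurable_completion)
    have "has_bochner_integral lborel (\<lambda>y. indicator U y * g y) (T g)"
      using intU[OF g] g by (simp add: has_bochner_integral_iff T_def)
    then have "has_bochner_integral lebesgue (\<lambda>y. indicator U y * g y) (T g)"
      by (simp add: has_bochner_integral_iff integrable_completion integral_completion)
    moreover have "(\<lambda>y. indicator U y * g y) \<in> borel_measurable lebesgue"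
      by (rule measurable_completion) measurable
    moreover have "(\<lambda>y. indicator E y * g y) \<in> borel_measurable lebesgue"
      by (intro borel_measurable_times borel_measurable_indicator gm Elb)
    moreover have "AE y in lebesgue. indicator E y * g y = indicator U y * g y"
      using EU by eventually_elim (simp add: indicator_def)
    ultimately show "has_bochner_integral lebesgue (\<lambda>y. indicator E y * g y) (T g)"
      using has_bochner_integral_cong_AE by blast
  qed

  have S0: "\<phi>0 \<in> schwartz_space" and S1: "\<phi> \<in> schwartz_space" using adm by (auto simp: admissible_pair_def)
  note dS = dyadic_schwartz[OF S0 S1]
  note meas\<phi> = schwartz_measurable[OF S1]
  let ?conv = "\<lambda>j x. LINT y|lborel. indicator U y * dyadic \<phi>0 \<phi> j (x - y)"
  have conv: "conv_distribution (dyadic \<phi>0 \<phi> j) T = ?conv j" for j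
    unfolding conv_distribution_def T_def using schwartz_reflect[OF dS] by simp

  obtain A0 where A0: "A0 \<ge> 0" "(\<integral>\<^sup>+x. ennreal (norm (\<phi>0 x)) \<partial>lborel) = ennreal A0"
    using schwartz_integrable[OF S0] by (auto simp: integrable_iff_bounded less_top_ennreal)
  obtain A1 where A1: "A1 \<ge> 0" "(\<integral>\<^sup>+x. ennreal (norm (\<phi> x)) \<partial>lborel) = ennreal A1"
    using schwartz_integrable[OF S1] by (auto simp: integrable_iff_bounded less_top_ennreal)
  define A where "A = A0 + A1 + 1"
  have A: "A > 0" using A0 A1 by (simp add: A_def)
  have norm_dyadic: "(\<integral>\<^sup>+x. ennreal (norm (dyadic \<phi>0 \<phi> j x)) \<partial>lborel) \<le> ennreal A" for j
  proof (cases "j = 0")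
    case True
    then show ?thesis using A0 A1 by (simp add: dyadic_def A_def)
  next
    case False
    then show ?thesis using A0 A1 nn_integral_dyadic[OF meas\<phi>, of j] by (simp add: A_def)
  qed
  have "(\<integral>\<^sup>+x. ennreal (norm (\<phi> x) * norm x) \<partial>lborel)
      \<le> (\<integral>\<^sup>+x. ennreal (norm (\<phi> x) * (1 + norm x)) \<partial>lborel)"
    by (intro nn_integral_mono ennreal_leI mult_left_mono) auto
  also have "\<dots> < \<infinity>" by (rule schwartz_first_moment_finite[OF S1])
  finally obtain M where M: "M \<ge> 0" "(\<integral>\<^sup>+x. ennreal (norm (\<phi> x) * norm x) \<partial>lborel) = ennreal M"
    by (auto simp: less_top_ennreal)
  define K where "K = 2 * C + 4 * m"
  have K: "K \<ge> 0" using C m by (simp add: K_def)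
  \<comment> \<open>\<open>A * m\<close> covers \<open>j = 0\<close>, \<open>K * M\<close> the other blocks; the summand \<open>1\<close> makes \<open>D\<close> positive\<close>
  define D where "D = A * m + K * M + 1"
  have D: "D > 0" using A K M m by (simp add: D_def add_nonneg_pos)

  have L1: "(\<integral>\<^sup>+x. ennreal (norm (?conv j x)) \<partial>lborel) \<le> ennreal (D / 2 ^ j)" for j
  proof (cases "j = 0")
    case True
    have "(\<integral>\<^sup>+x. ennreal (norm (?conv j x)) \<partial>lborel) \<le> ennreal (A * m)"
      using A m by (intro nn_integral_conv_indicator_le_measure U schwartz_measurable dS norm_dyadic) auto
    also have "\<dots> \<le> ennreal (D / 2 ^ j)"
      using True K M by (intro ennreal_leI) (simp add: D_def)
    finally show ?thesis .
  next
    case False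
    have "(\<integral>\<^sup>+x. ennreal (norm (dyadic \<phi>0 \<phi> j x) * norm x) \<partial>lborel) = ennreal (1 / 2 ^ j * M)"
      using False nn_integral_dyadic_moment[OF meas\<phi>, of j] M by (simp add: ennreal_mult'[symmetric])
    then have "(\<integral>\<^sup>+x. ennreal (norm (?conv j x)) \<partial>lborel) \<le> ennreal (K * (1 / 2 ^ j * M))"
      using False K unfolding K_def
      by (intro nn_integral_conv_indicator_le_moment U schwartz_measurable schwartz_integrable dS
          dyadic_integral_zero[OF adm] nn_integral_translation_difference oU C contentU) (auto simp: m)
    also have "\<dots> \<le> ennreal (D / 2 ^ j)"
      using A m by (intro ennreal_leI) (simp add: D_def divide_simps)
    finally show ?thesis .
  qed

  define s where "s = enn2real (1 / p)"
  have "ennreal (2 powr (real j * s)) * Lp_norm p (conv_distribution (dyadic \<phi>0 \<phi> j) T)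
      \<le> ennreal (A powr (1 - s) * D powr s)" for j
  proof -
    have "Lp_norm p (?conv j) \<le> ennreal (A powr (1 - s) * (D / 2 ^ j) powr s)"
      unfolding s_def
      by (intro Lp_norm_interpolation conv_indicator_measurable norm_conv_indicator_le
          U schwartz_measurable dS norm_dyadic L1 p) (use A D in auto)
    then have "ennreal (2 powr (real j * s)) * Lp_norm p (?conv j)
        \<le> ennreal (2 powr (real j * s) * (A powr (1 - s) * (D / 2 ^ j) powr s))"
      by (simp add: ennreal_mult' mult_left_mono)
    also have "2 powr (real j * s) * (A powr (1 - s) * (D / 2 ^ j) powr s) = A powr (1 - s) * D powr s"
      using D by (simp add: powr_divide powr_powr flip: powr_realpow)
    finally show ?thesis by (simp add: conv)
  qed
  then have "besov_norm \<phi>0 \<phi> s p T \<le> ennreal (A powr (1 - s) * D powr s)"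
    unfolding besov_norm_def by (intro SUP_least)
  then have "besov_norm \<phi>0 \<phi> s p T < \<infinity>" by (simp add: le_less_trans)
  then show ?thesis using temp gen unfolding besov_space_def s_def by blast
qed

section \<open>Geometry of the spiral\<close>

text \<open>The isometry with the complex plane makes polar coordinates, rotations and the continuity of the
argument available.\<close>

definition plane_of_complex :: "complex \<Rightarrow> real ^ 2" where
  "plane_of_complex z = vector [Re z, Im z]"

lemma norm_plane_of_complex [simp]: "norm (plane_of_complex z) = norm z"
  by (simp add: plane_of_complex_def norm_vec_def L2_set_def UNIV_2 cmod_def)

lemma plane_of_complex_diff: "plane_of_complex (z - w) = plane_of_complex z - plane_of_complex w"
  by (simp add: plane_of_complex_def vec_eq_iff forall_2)

lemma plane_of_complex_minus: "plane_of_complex (- z) = - plane_of_complex z"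
  by (simp add: plane_of_complex_def vec_eq_iff forall_2)

lemma dist_plane_of_complex [simp]: "dist (plane_of_complex z) (plane_of_complex w) = dist z w"
  by (simp add: dist_norm flip: plane_of_complex_diff)

lemma surj_plane_of_complex: "\<exists>z. x = plane_of_complex z"
  by (rule exI[of _ "Complex (x $ 1) (x $ 2)"]) (simp add: plane_of_complex_def vec_eq_iff forall_2)

lemma continuous_on_plane_of_complex [continuous_intros]:
  assumes "continuous_on S f"
  shows "continuous_on S (\<lambda>x. plane_of_complex (f x))"
proof -
  have "continuous_on UNIV plane_of_complex"
    unfolding continuous_on_iff dist_plane_of_complex by blast
  then show ?thesis using assms by (rule continuous_on_compose2) simp
qed

definition spiral_radius :: "real \<Rightarrow> real" where
  "spiral_radius t = 1 / (t * (log 2 t)\<^sup>2)"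

definition spiral_curve :: "real \<Rightarrow> real ^ 2" where
  "spiral_curve t = plane_of_complex (of_real (spiral_radius t) * cis t)"

lemma spiral_domain_eq:
  "spiral_domain = {plane_of_complex (of_real r * cis t) | r t.
     spiral_radius (t + pi) \<le> r \<and> r < spiral_radius t \<and> 2 * pi \<le> t}"
  unfolding spiral_domain_def spiral_radius_def plane_of_complex_def by simp

lemma spiral_radius_pos: "1 < t \<Longrightarrow> 0 < spiral_radius t"
  using zero_less_log_cancel_iff[of 2 t] by (simp add: spiral_radius_def del: zero_less_log_cancel_iff)

lemma spiral_radius_antimono:
  assumes "1 < s" "s \<le> t"
  shows "spiral_radius t \<le> spiral_radius s"
  unfolding spiral_radius_def
  using assms by (intro divide_left_mono mult_mono power_mono mult_pos_pos zero_less_power) auto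

lemma spiral_radius_le_ln:
  assumes "1 < t"
  shows "spiral_radius t \<le> 1 / (t * (ln t)\<^sup>2)"
proof -
  have "ln 2 \<le> (1::real)" by (rule order_trans[OF ln_le_minus_one]) auto
  then have "ln t \<le> log 2 t" using assms by (simp add: log_def field_simps mult_left_le)
  then show ?thesis
    unfolding spiral_radius_def using assms
    by (intro divide_left_mono mult_left_mono power_mono mult_pos_pos zero_less_power) auto
qed

lemma ln_ge_one: "3 \<le> t \<Longrightarrow> 1 \<le> ln (t::real)"
  using exp_le by (subst ln_ge_iff) auto

lemma two_pi_ge_six: "6 \<le> 2 * pi"
  using pi_gt3 by simp

lemma spiral_radius_le_inverse:
  assumes "3 \<le> t"
  shows "spiral_radius t \<le> 1 / t"
proof -
  have "1 \<le> (ln t)\<^sup>2" using ln_ge_one[OF assms] by (simp add: one_le_power)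
  then have "1 / (t * (ln t)\<^sup>2) \<le> 1 / t"
    using assms by (intro divide_left_mono) (auto simp: mult_le_cancel_left1)
  then show ?thesis using spiral_radius_le_ln[of t] assms by simp
qed

lemma spiral_radius_deriv:
  assumes "1 < t"
  shows "(spiral_radius has_real_derivative - (spiral_radius t * (1 + 2 / ln t) / t)) (at t)"
proof -
  have "((\<lambda>t. (ln 2)\<^sup>2 * inverse (t * (ln t)\<^sup>2)) has_real_derivative
      - (spiral_radius t * (1 + 2 / ln t) / t)) (at t)"
    using assms
    by (auto intro!: derivative_eq_intros simp: spiral_radius_def log_def field_simps power2_eq_square)
  moreover have "spiral_radius = (\<lambda>t. (ln 2)\<^sup>2 * inverse (t * (ln t)\<^sup>2))"
    by (auto simp: spiral_radius_def log_def field_simps)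
  ultimately show ?thesis by simp
qed

text \<open>For arguments at least \<open>3\<close> the logarithm is at least \<open>1\<close>, so the relative slope
\<open>(1 + 2 / ln u) / u\<close> of the radius is at most \<open>1\<close>. Hence an arc of the spiral over one turn is
parametrised with speed at most twice its initial radius.\<close>

lemma spiral_radius_lipschitz:
  assumes "3 \<le> a" "a \<le> s" "a \<le> t"
  shows "\<bar>spiral_radius s - spiral_radius t\<bar> \<le> spiral_radius a * \<bar>s - t\<bar>"
proof -
  have "norm (spiral_radius s - spiral_radius t) \<le> spiral_radius a * norm (s - t)"
  proof (rule field_differentiable_bound[where S = "{a..}" and
      f' = "\<lambda>u. - (spiral_radius u * (1 + 2 / ln u) / u)"])
    fix u assume u: "u \<in> {a..}"
    then have u3: "3 \<le> u" using assms by simp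
    show "(spiral_radius has_real_derivative - (spiral_radius u * (1 + 2 / ln u) / u)) (at u within {a..})"
      by (rule has_field_derivative_at_within, rule spiral_radius_deriv) (use u3 in simp)
    have pos: "0 < spiral_radius u" using u3 by (intro spiral_radius_pos) simp
    have ln: "1 \<le> ln u" using u3 by (rule ln_ge_one)
    have "2 / ln u \<le> 2" using ln by (simp add: field_simps)
    then have "1 + 2 / ln u \<le> u" using u3 by linarith
    then have "(1 + 2 / ln u) / u \<le> 1" using u3 by (simp add: divide_le_eq)
    moreover have "0 \<le> (1 + 2 / ln u) / u" using ln u3 by simp
    ultimately have "\<bar>spiral_radius u * ((1 + 2 / ln u) / u)\<bar> \<le> spiral_radius u * 1"
      unfolding abs_mult using pos by (intro mult_mono) auto
    then have "norm (- (spiral_radius u * (1 + 2 / ln u) / u)) \<le> spiral_radius u * 1"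
      by (simp only: norm_minus_cancel real_norm_def times_divide_eq_right)
    also have "\<dots> \<le> spiral_radius a" using spiral_radius_antimono[of a u] assms u by simp
    finally show "norm (- (spiral_radius u * (1 + 2 / ln u) / u)) \<le> spiral_radius a" .
  qed (use assms in auto)
  then show ?thesis by simp
qed

lemma dist_cis_le: "norm (cis s - cis t) \<le> \<bar>s - t\<bar>"
proof -
  have "cis s - cis t = cis t * (cis (s - t) - 1)"
    by (simp add: right_diff_distrib cis_mult)
  then have "norm (cis s - cis t) = 2 * \<bar>sin ((s - t) / 2)\<bar>"
    using dist_exp_i_1[of "s - t"] by (simp add: norm_mult cis_conv_exp)
  also have "\<dots> \<le> \<bar>s - t\<bar>" using abs_sin_x_le_abs_x[of "(s - t) / 2"] by simp
  finally show ?thesis .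
qed

lemma norm_spiral_curve: "1 < t \<Longrightarrow> norm (spiral_curve t) = spiral_radius t"
  using spiral_radius_pos[of t] by (simp add: spiral_curve_def norm_mult)

lemma spiral_curve_lipschitz:
  assumes "3 \<le> a" "a \<le> s" "a \<le> t"
  shows "dist (spiral_curve s) (spiral_curve t) \<le> 2 * spiral_radius a * \<bar>s - t\<bar>"
proof -
  let ?g = spiral_radius
  have "of_real (?g s) * cis s - of_real (?g t) * cis t
      = of_real (?g s - ?g t) * cis s + of_real (?g t) * (cis s - cis t)"
    by (simp add: algebra_simps)
  then have "dist (spiral_curve s) (spiral_curve t)
      \<le> norm (of_real (?g s - ?g t) * cis s) + norm (of_real (?g t) * (cis s - cis t))"
    unfolding spiral_curve_def dist_plane_of_complex unfolding dist_norm by (metis norm_triangle_ineq)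
  also have "\<dots> = \<bar>?g s - ?g t\<bar> + ?g t * norm (cis s - cis t)"
    using spiral_radius_pos[of t] assms by (simp add: norm_mult flip: of_real_diff)
  also have "\<dots> \<le> ?g a * \<bar>s - t\<bar> + ?g a * \<bar>s - t\<bar>"
    using assms spiral_radius_pos[of a]
    by (intro add_mono mult_mono spiral_radius_lipschitz spiral_radius_antimono dist_cis_le) auto
  finally show ?thesis by simp
qed

text \<open>This is where the square of the logarithm enters: the lengths of the turns are summable. The
terms are dominated by the telescoping differences of \<open>1 / ln (k + 2)\<close>, by
\<open>1 / x \<le> ln x - ln (x - 1)\<close>.\<close>

lemma summable_spiral_radius: "summable (\<lambda>k. spiral_radius (2 * pi * (real k + 1)))"
proof (rule summable_comparison_test')
  let ?c = "\<lambda>k. 1 / ln (real k + 2)"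
  have "?c \<longlonglongrightarrow> 0" by real_asymp
  then show "summable (\<lambda>k. ?c k - ?c (Suc k))" by (rule telescope_summable')
  fix k :: nat
  define x where "x = real k + 3"
  have x: "3 \<le> x" by (simp add: x_def)
  have "6 * (real k + 1) \<le> 2 * pi * (real k + 1)"
    by (intro mult_right_mono two_pi_ge_six) simp
  then have xle: "x \<le> 2 * pi * (real k + 1)" by (simp add: x_def)
  have ln: "0 < ln (x - 1)" "ln (x - 1) \<le> ln x" "0 < ln x" using x by auto
  have "ln (x - 1) - ln x = ln ((x - 1) / x)" using x by (simp add: ln_div)
  also have "\<dots> \<le> (x - 1) / x - 1" using x by (intro ln_le_minus_one) simp
  also have "\<dots> = - (1 / x)" using x by (simp add: field_simps)
  finally have step: "1 / x \<le> ln x - ln (x - 1)" by simp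
  have "spiral_radius (2 * pi * (real k + 1)) \<le> spiral_radius x"
    using x xle by (intro spiral_radius_antimono) auto
  also have "\<dots> \<le> 1 / (x * (ln x)\<^sup>2)" using x by (intro spiral_radius_le_ln) simp
  also have "\<dots> = (1 / x) / (ln x * ln x)" by (simp add: power2_eq_square)
  also have "\<dots> \<le> (ln x - ln (x - 1)) / (ln (x - 1) * ln x)"
    using ln step x by (intro frac_le mult_right_mono mult_pos_pos) auto
  also have "\<dots> = ?c k - ?c (Suc k)"
    using ln by (simp add: x_def divide_simps add_ac)
  finally show "norm (spiral_radius (2 * pi * (real k + 1))) \<le> ?c k - ?c (Suc k)"
    using spiral_radius_pos[of "2 * pi * (real k + 1)"] x xle by simp
qed

text \<open>The path is cut into at most \<open>L * (b - a) / h + 1\<close> pieces of length at most \<open>h\<close>; the balls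
of radius \<open>2 * h\<close> at the division points cover the \<open>h\<close>-neighbourhood. The summand \<open>2 * h\<close>
comes from rounding the number of pieces up and from the additional end point.\<close>

lemma emeasure_thickened_lipschitz_path:
  fixes \<gamma> :: "real \<Rightarrow> real ^ 2"
  assumes lip: "\<And>s t. s \<in> {a..b} \<Longrightarrow> t \<in> {a..b} \<Longrightarrow> dist (\<gamma> s) (\<gamma> t) \<le> L * \<bar>s - t\<bar>"
    and ab: "a < b" and L: "0 \<le> L" and h: "0 < h"
  shows "emeasure lborel (\<Union>w\<in>\<gamma> ` {a..b}. ball w h) \<le> ennreal (4 * pi * h * (L * (b - a) + 2 * h))"
proof -
  define X where "X = L * (b - a) / h"
  have X: "0 \<le> X" using L ab h by (simp add: X_def)
  define n where "n = nat \<lfloor>X\<rfloor> + 1"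
  have n: "X \<le> real n" "real n \<le> X + 1" "0 < real n"
    unfolding n_def using X by linarith+
  define c where "c i = a + real i * (b - a) / real n" for i
  have c: "c i \<in> {a..b}" if "i \<le> n" for i
  proof -
    have "real i * (b - a) \<le> real n * (b - a)" using that ab by (intro mult_right_mono) auto
    then have "real i * (b - a) / real n \<le> b - a" using n by (simp add: divide_le_eq mult.commute)
    then show ?thesis using ab n by (simp add: c_def)
  qed
  have sub: "(\<Union>w\<in>\<gamma> ` {a..b}. ball w h) \<subseteq> (\<Union>i\<in>{..n}. ball (\<gamma> (c i)) (2 * h))"
  proof
    fix x assume "x \<in> (\<Union>w\<in>\<gamma> ` {a..b}. ball w h)"
    then obtain t where t: "t \<in> {a..b}" "dist (\<gamma> t) x < h" by auto
    define u where "u = (t - a) * real n / (b - a)"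
    define i where "i = nat \<lfloor>u\<rfloor>"
    have u: "0 \<le> u" "u \<le> real n" using t ab n by (auto simp: u_def divide_le_eq mult.commute mult_left_mono)
    have i: "real i \<le> u" "u \<le> real i + 1" unfolding i_def using u by linarith+
    have in_: "i \<le> n" using i u by linarith
    have t_eq: "t = a + u * (b - a) / real n" using ab n by (simp add: u_def)
    have "\<bar>c i - t\<bar> = \<bar>real i - u\<bar> * ((b - a) / real n)"
    proof -
      have "c i - t = (real i - u) * ((b - a) / real n)"
        unfolding c_def t_eq by (simp add: left_diff_distrib add_divide_distrib flip: times_divide_eq_right)
      then show ?thesis using ab n by (simp add: abs_mult)
    qed
    also have "\<dots> \<le> 1 * ((b - a) / real n)" using i ab n by (intro mult_right_mono) auto
    finally have "L * \<bar>c i - t\<bar> \<le> L * ((b - a) / real n)" using L by (intro mult_left_mono) auto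
    also have "\<dots> \<le> h" using n h by (simp add: X_def field_simps)
    finally have "dist (\<gamma> (c i)) (\<gamma> t) \<le> h" using lip[OF c[OF in_] t(1)] by linarith
    then have "dist (\<gamma> (c i)) x < 2 * h" using t(2) dist_triangle[of "\<gamma> (c i)" x "\<gamma> t"] by linarith
    then show "x \<in> (\<Union>i\<in>{..n}. ball (\<gamma> (c i)) (2 * h))" using in_ by auto
  qed
  have "emeasure lborel (\<Union>w\<in>\<gamma> ` {a..b}. ball w h) \<le> emeasure lborel (\<Union>i\<in>{..n}. ball (\<gamma> (c i)) (2 * h))"
    by (intro emeasure_mono sub) auto
  also have "\<dots> \<le> (\<Sum>i\<in>{..n}. emeasure lborel (ball (\<gamma> (c i)) (2 * h)))"
    by (intro emeasure_subadditive_finite) auto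
  also have "\<dots> = (\<Sum>i\<in>{..n}. ennreal (4 * pi * h\<^sup>2))"
    using h by (simp add: emeasure_ball unit_ball_vol_2 power_mult_distrib mult_ac)
  also have "\<dots> = ennreal ((real n + 1) * (4 * pi * h\<^sup>2))"
    by (subst sum_ennreal) auto
  also have "\<dots> \<le> ennreal ((X + 2) * (4 * pi * h\<^sup>2))"
    using n by (intro ennreal_leI mult_right_mono) auto
  also have "(X + 2) * (4 * pi * h\<^sup>2) = 4 * pi * h * (L * (b - a) + 2 * h)"
    using h by (simp add: X_def field_simps power2_eq_square)
  finally show ?thesis .
qed

text \<open>A turn whose radius exceeds \<open>h\<close> has a neighbourhood of measure \<open>O(h)\<close> times that radius, since
the quadratic term of the covering bound is absorbed. The neighbourhoods of all turns with radius
at most \<open>h\<close> lie in a single ball of radius \<open>2 * h\<close>. Summing therefore costs only the sum \<open>S\<close>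
of the radii. The curve is left abstract so that the statement covers both the outer
spiral and its reflection.\<close>

lemma emeasure_thickened_spiral:
  fixes \<gamma> :: "real \<Rightarrow> real ^ 2"
  assumes norm: "\<And>t. 2 * pi \<le> t \<Longrightarrow> norm (\<gamma> t) = spiral_radius t"
    and lip: "\<And>a s t. 2 * pi \<le> a \<Longrightarrow> a \<le> s \<Longrightarrow> a \<le> t \<Longrightarrow>
      dist (\<gamma> s) (\<gamma> t) \<le> 2 * spiral_radius a * \<bar>s - t\<bar>"
    and h: "0 < h" "h \<le> 1"
  defines "S \<equiv> (\<Sum>k. spiral_radius (2 * pi * (real k + 1)))"
  shows "emeasure lborel (\<Union>w\<in>\<gamma> ` {2 * pi..}. ball w h) \<le> ennreal ((4 * pi + 4 * pi * (4 * pi + 2) * S) * h)"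
proof -
  define \<tau> where "\<tau> k = 2 * pi * (real k + 1)" for k
  have \<tau>: "2 * pi \<le> \<tau> k" "\<tau> k < \<tau> (Suc k)" "\<tau> (Suc k) - \<tau> k = 2 * pi" for k
    by (simp_all add: \<tau>_def algebra_simps)
  have pos: "0 < spiral_radius (\<tau> k)" for k
    using \<tau>(1)[of k] two_pi_ge_six by (intro spiral_radius_pos) linarith
  \<comment> \<open>only the turns that do not fit into the central ball contribute\<close>
  define A where "A k = (if h < spiral_radius (\<tau> k) then \<Union>w\<in>\<gamma> ` {\<tau> k..\<tau> (Suc k)}. ball w h else {})" for k
  have A_meas: "A k \<in> sets lborel" for k by (auto simp: A_def intro!: borel_open)
  have A_le: "emeasure lborel (A k) \<le> ennreal (4 * pi * (4 * pi + 2) * h * spiral_radius (\<tau> k))" for k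
  proof (cases "h < spiral_radius (\<tau> k)")
    case True
    have "emeasure lborel (A k) \<le> ennreal (4 * pi * h * (2 * spiral_radius (\<tau> k) * (\<tau> (Suc k) - \<tau> k) + 2 * h))"
      unfolding A_def if_P[OF True]
    proof (rule emeasure_thickened_lipschitz_path)
      show "dist (\<gamma> s) (\<gamma> t) \<le> 2 * spiral_radius (\<tau> k) * \<bar>s - t\<bar>"
        if "s \<in> {\<tau> k..\<tau> (Suc k)}" "t \<in> {\<tau> k..\<tau> (Suc k)}" for s t
        using that \<tau>(1)[of k] by (intro lip) auto
    qed (use \<tau>(2)[of k] pos[of k] h in auto)
    also have "\<dots> \<le> ennreal (4 * pi * h * (2 * spiral_radius (\<tau> k) * (2 * pi) + 2 * spiral_radius (\<tau> k)))"
      using True h \<tau>(3) by (intro ennreal_leI mult_left_mono) auto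
    finally show ?thesis by (simp add: algebra_simps)
  qed (simp add: A_def)
  have "(\<Union>w\<in>\<gamma> ` {2 * pi..}. ball w h) \<subseteq> ball 0 (2 * h) \<union> (\<Union>k. A k)"
  proof
    fix x assume "x \<in> (\<Union>w\<in>\<gamma> ` {2 * pi..}. ball w h)"
    then obtain t where t: "2 * pi \<le> t" "dist (\<gamma> t) x < h" by auto
    define k where "k = nat (\<lfloor>t / (2 * pi)\<rfloor> - 1)"
    have "1 \<le> t / (2 * pi)" using t by simp
    then have "real k + 1 \<le> t / (2 * pi)" "t / (2 * pi) \<le> real k + 2" unfolding k_def by linarith+
    then have k: "t \<in> {\<tau> k..\<tau> (Suc k)}" by (simp add: \<tau>_def field_simps)
    show "x \<in> ball 0 (2 * h) \<union> (\<Union>k. A k)"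
    proof (cases "h < spiral_radius (\<tau> k)")
      case True
      then have "x \<in> A k" using k t by (auto simp: A_def)
      then show ?thesis by blast
    next
      case False
      have "norm (\<gamma> t) \<le> spiral_radius (\<tau> k)"
        using norm[OF t(1)] k \<tau>(1)[of k] two_pi_ge_six spiral_radius_antimono[of "\<tau> k" t] by auto
      then have "norm x < 2 * h"
        using False t(2) norm_triangle_sub[of x "\<gamma> t"] by (simp add: dist_norm norm_minus_commute)
      then show ?thesis by simp
    qed
  qed
  then have "emeasure lborel (\<Union>w\<in>\<gamma> ` {2 * pi..}. ball w h) \<le> emeasure lborel (ball 0 (2 * h) \<union> (\<Union>k. A k))"
    using A_meas by (intro emeasure_mono) auto
  also have "\<dots> \<le> emeasure lborel (ball (0 :: real ^ 2) (2 * h)) + emeasure lborel (\<Union>k. A k)"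
    using A_meas by (intro emeasure_subadditive) auto
  also have "\<dots> \<le> ennreal (4 * pi * h) + (\<Sum>k. ennreal (4 * pi * (4 * pi + 2) * h * spiral_radius (\<tau> k)))"
  proof (rule add_mono)
    have "h * h \<le> h * 1" using h by (intro mult_left_mono) auto
    then show "emeasure lborel (ball (0 :: real ^ 2) (2 * h)) \<le> ennreal (4 * pi * h)"
      using h by (simp add: emeasure_ball unit_ball_vol_2 power2_eq_square)
    have "emeasure lborel (\<Union>k. A k) \<le> (\<Sum>k. emeasure lborel (A k))"
      using A_meas by (intro emeasure_subadditive_countably) auto
    also have "\<dots> \<le> (\<Sum>k. ennreal (4 * pi * (4 * pi + 2) * h * spiral_radius (\<tau> k)))"
      by (intro suminf_le A_le) auto
    finally show "emeasure lborel (\<Union>k. A k) \<le> (\<Sum>k. ennreal (4 * pi * (4 * pi + 2) * h * spiral_radius (\<tau> k)))" .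
  qed
  also have "(\<Sum>k. ennreal (4 * pi * (4 * pi + 2) * h * spiral_radius (\<tau> k)))
      = ennreal (\<Sum>k. 4 * pi * (4 * pi + 2) * h * spiral_radius (\<tau> k))"
  proof (rule suminf_ennreal2)
    show "0 \<le> 4 * pi * (4 * pi + 2) * h * spiral_radius (\<tau> k)" for k
      using h pos[of k] by (intro mult_nonneg_nonneg) auto
    show "summable (\<lambda>k. 4 * pi * (4 * pi + 2) * h * spiral_radius (\<tau> k))"
      using summable_spiral_radius unfolding \<tau>_def by (rule summable_mult)
  qed
  also have "(\<Sum>k. 4 * pi * (4 * pi + 2) * h * spiral_radius (\<tau> k)) = 4 * pi * (4 * pi + 2) * h * S"
    using summable_spiral_radius unfolding S_def \<tau>_def by (rule suminf_mult)
  also have "ennreal (4 * pi * h) + ennreal (4 * pi * (4 * pi + 2) * h * S)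
      = ennreal ((4 * pi + 4 * pi * (4 * pi + 2) * S) * h)"
  proof -
    have "0 \<le> S" unfolding S_def
      using pos by (intro suminf_nonneg summable_spiral_radius) (simp add: \<tau>_def less_imp_le)
    then show ?thesis using h by (subst ennreal_plus[symmetric]) (auto simp: algebra_simps)
  qed
  finally show ?thesis .
qed

text \<open>Away from the origin the angle stays bounded: points of angle beyond \<open>T\<close> lie in the disc of
radius \<^term>\<open>spiral_radius T\<close>, and this radius is less than \<open>norm x\<close> for large \<open>T\<close>. The
remaining part of the domain lies in the image of a compact set of polar coordinates.\<close>

lemma spiral_closure:
  assumes "x \<in> closure spiral_domain" "x \<noteq> 0"
  obtains r t where "x = plane_of_complex (of_real r * cis t)"
    "spiral_radius (t + pi) \<le> r" "r \<le> spiral_radius t" "2 * pi \<le> t"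
proof -
  define T where "T = 2 * pi + 2 / norm x"
  have x: "0 < norm x" using assms by simp
  have T: "2 * pi \<le> T" "2 / norm x \<le> T" using x by (auto simp: T_def)
  have T3: "3 \<le> T" using T two_pi_ge_six by linarith
  have "1 / T < norm x"
  proof -
    have "1 / norm x < T" using T(2) x by (smt (verit) divide_strict_right_mono)
    then show ?thesis using x T3 by (simp add: field_simps)
  qed
  then have gT: "spiral_radius T < norm x" using spiral_radius_le_inverse[OF T3] by linarith
  define K where "K = {(r, t). t \<in> {2 * pi..T} \<and> spiral_radius (t + pi) \<le> r \<and> r \<le> spiral_radius t}"
  have cont: "continuous_on {3..} spiral_radius"
    using DERIV_isCont[OF spiral_radius_deriv] by (intro continuous_at_imp_continuous_on) auto
  have "compact K"
  proof -
    let ?box = "{0..1} \<times> {2 * pi..T}"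
    have "continuous_on ?box (\<lambda>z. spiral_radius (snd z + pi))" "continuous_on ?box (\<lambda>z. spiral_radius (snd z))"
      using two_pi_ge_six pi_gt3
      by (intro continuous_on_compose2[OF cont] continuous_intros; force)+
    then have "closed {z \<in> ?box. spiral_radius (snd z + pi) \<le> fst z}" "closed {z \<in> ?box. fst z \<le> spiral_radius (snd z)}"
      by (auto intro!: continuous_on_closed_Collect_le continuous_on_fst continuous_on_id closed_Times)
    then have "compact (?box \<inter> ({z \<in> ?box. spiral_radius (snd z + pi) \<le> fst z} \<inter> {z \<in> ?box. fst z \<le> spiral_radius (snd z)}))"
      by (intro compact_Int_closed compact_Times closed_Int) auto
    also have "?box \<inter> ({z \<in> ?box. spiral_radius (snd z + pi) \<le> fst z} \<inter> {z \<in> ?box. fst z \<le> spiral_radius (snd z)}) = K"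
    proof -
      have "0 \<le> r \<and> r \<le> 1" if "2 * pi \<le> t" "spiral_radius (t + pi) \<le> r" "r \<le> spiral_radius t" for r t
      proof -
        have t: "3 \<le> t" using that two_pi_ge_six by linarith
        then have "1 / t \<le> 1" by simp
        then show ?thesis using that spiral_radius_pos[of "t + pi"] spiral_radius_le_inverse[OF t] t pi_gt3 by linarith
      qed
      then show ?thesis unfolding K_def by auto
    qed
    finally show ?thesis .
  qed
  then have "closed ((\<lambda>(r, t). plane_of_complex (of_real r * cis t)) ` K)"
    by (intro compact_imp_closed compact_continuous_image)
       (auto simp: case_prod_unfold intro!: continuous_intros)
  then have cl: "closed ((\<lambda>(r, t). plane_of_complex (of_real r * cis t)) ` K \<union> cball 0 (spiral_radius T))"
    by (intro closed_Un closed_cball)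
  have "spiral_domain \<subseteq> (\<lambda>(r, t). plane_of_complex (of_real r * cis t)) ` K \<union> cball 0 (spiral_radius T)"
  proof
    fix y assume "y \<in> spiral_domain"
    then obtain r t where y: "y = plane_of_complex (of_real r * cis t)"
      and r: "spiral_radius (t + pi) \<le> r" "r < spiral_radius t" and t: "2 * pi \<le> t"
      unfolding spiral_domain_eq by blast
    show "y \<in> (\<lambda>(r, t). plane_of_complex (of_real r * cis t)) ` K \<union> cball 0 (spiral_radius T)"
    proof (cases "t \<le> T")
      case True
      then have "(r, t) \<in> K" using r t by (simp add: K_def)
      then show ?thesis using y by force
    next
      case False
      have "0 < r" using r(1) spiral_radius_pos[of "t + pi"] t two_pi_ge_six pi_gt3 by linarith
      moreover have "r \<le> spiral_radius T" using r False T3 spiral_radius_antimono[of T t] by linarith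
      ultimately have "norm y \<le> spiral_radius T" using y by (simp add: norm_mult)
      then show ?thesis by simp
    qed
  qed
  then have "closure spiral_domain \<subseteq> (\<lambda>(r, t). plane_of_complex (of_real r * cis t)) ` K \<union> cball 0 (spiral_radius T)"
    using cl by (rule closure_minimal)
  then have "x \<in> (\<lambda>(r, t). plane_of_complex (of_real r * cis t)) ` K" using assms(1) gT by auto
  then obtain r t where "(r, t) \<in> K" "x = plane_of_complex (of_real r * cis t)" by auto
  then show ?thesis using that unfolding K_def by auto
qed

text \<open>Strict inequalities persist nearby, because \<open>w \<mapsto> t + Arg (w / z)\<close> is a continuous choice
of the unreduced angle around the point \<open>z\<close> of angle \<open>t\<close>.\<close>

lemma spiral_interior:
  assumes r: "spiral_radius (t + pi) < r" "r < spiral_radius t" and t: "2 * pi < t"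
  shows "plane_of_complex (of_real r * cis t) \<in> interior spiral_domain"
proof -
  define z where "z = of_real r * cis t"
  have r0: "0 < r" using r(1) spiral_radius_pos[of "t + pi"] t two_pi_ge_six pi_gt3 by linarith
  then have z0: "z \<noteq> 0" by (simp add: z_def)
  have nz: "norm z = r" using r0 by (simp add: z_def norm_mult)
  define \<theta> where "\<theta> w = t + Arg (w / z)" for w
  have \<theta>z: "\<theta> z = t" using z0 by (simp add: \<theta>_def)
  have \<theta>: "isCont \<theta> z"
    unfolding \<theta>_def using z0 by (intro continuous_intros isCont_o2[OF _ continuous_at_Arg]) auto
  have g: "isCont spiral_radius u" if "1 < u" for u
    using spiral_radius_deriv[OF that] by (rule DERIV_isCont)
  have t1: "1 < t" using t two_pi_ge_six by linarith
  have lim\<theta>: "(\<theta> \<longlongrightarrow> t) (nhds z)"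
    using \<theta> \<theta>z tendsto_at_iff_tendsto_nhds[of \<theta> z] by (simp add: continuous_at)
  have limg: "((\<lambda>w. spiral_radius (\<theta> w)) \<longlongrightarrow> spiral_radius t) (nhds z)"
    by (rule isCont_tendsto_compose[OF g[OF t1] lim\<theta>])
  have limg': "((\<lambda>w. spiral_radius (\<theta> w + pi)) \<longlongrightarrow> spiral_radius (t + pi)) (nhds z)"
    by (rule isCont_tendsto_compose[OF g]) (use t1 pi_gt3 lim\<theta> in \<open>auto intro!: tendsto_intros\<close>)
  have "((\<lambda>w. norm w) \<longlongrightarrow> norm z) (nhds z)" by (intro tendsto_norm filterlim_ident)
  then have limr: "((\<lambda>w. norm w) \<longlongrightarrow> r) (nhds z)" using r0 by (simp add: z_def norm_mult)
  have "\<forall>\<^sub>F w in nhds z. 0 < spiral_radius (\<theta> w) - norm w"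
    using r by (intro order_tendstoD(1)[OF tendsto_diff[OF limg limr]]) simp
  moreover have "\<forall>\<^sub>F w in nhds z. 0 < norm w - spiral_radius (\<theta> w + pi)"
    using r by (intro order_tendstoD(1)[OF tendsto_diff[OF limr limg']]) simp
  moreover have "\<forall>\<^sub>F w in nhds z. 2 * pi < \<theta> w" using lim\<theta> t by (rule order_tendstoD(1))
  moreover have "\<forall>\<^sub>F w in nhds z. w \<noteq> 0"
    using z0 by (intro t1_space_nhds)
  ultimately have "\<forall>\<^sub>F w in nhds z. plane_of_complex w \<in> spiral_domain"
  proof eventually_elim
    case (elim w)
    have "cis (\<theta> w) = cis t * sgn (w / z)" using elim z0 by (simp add: \<theta>_def cis_mult[symmetric] cis_Arg)
    moreover have "cis t = z / of_real r" using r0 by (simp add: z_def)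
    ultimately have "of_real (norm w) * cis (\<theta> w) = of_real (norm w) * (z / of_real r * sgn (w / z))" by simp
    also have "of_real (norm w) * (z / of_real r * sgn (w / z)) = w"
      using elim z0 r0 nz by (simp add: sgn_eq norm_divide)
    finally have "w = of_real (norm w) * cis (\<theta> w)" by simp
    then show ?case unfolding spiral_domain_eq
      using elim by (intro CollectI exI[of _ "norm w"] exI[of _ "\<theta> w"]) (auto simp: less_imp_le)
  qed
  then obtain e where e: "0 < e" "\<And>w. dist w z < e \<Longrightarrow> plane_of_complex w \<in> spiral_domain"
    unfolding eventually_nhds_metric by blast
  have "ball (plane_of_complex z) e \<subseteq> spiral_domain"
  proof
    fix y assume "y \<in> ball (plane_of_complex z) e"
    moreover obtain w where "y = plane_of_complex w" using surj_plane_of_complex by blast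
    ultimately show "y \<in> spiral_domain" using e(2)[of w] by (simp add: dist_commute)
  qed
  then show ?thesis using e(1) unfolding z_def mem_interior by blast
qed

text \<open>The outer edge is the spiral itself. The inner edge has radius \<open>spiral_radius (t + pi)\<close> at
angle \<open>t\<close>; as \<open>cis (t + pi) = - cis t\<close>, it is part of the reflected spiral. The remaining
piece is the straight edge at \<open>t = 2 * pi\<close>, enlarged to the unit segment, which also takes
care of the limit point \<open>0\<close>.\<close>

lemma frontier_spiral_domain:
  "frontier spiral_domain \<subseteq> spiral_curve ` {2 * pi..} \<union> (\<lambda>t. - spiral_curve t) ` {2 * pi..}
     \<union> (\<lambda>r. plane_of_complex (of_real r)) ` {0..1}"
proof
  fix x assume x: "x \<in> frontier spiral_domain"
  show "x \<in> spiral_curve ` {2 * pi..} \<union> (\<lambda>t. - spiral_curve t) ` {2 * pi..}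
     \<union> (\<lambda>r. plane_of_complex (of_real r)) ` {0..1}"
  proof (cases "x = 0")
    case True
    then have "x = plane_of_complex (of_real 0)" 
      by (simp add: plane_of_complex_def vec_eq_iff forall_2)
    then show ?thesis by force
  next
    case False
    with x obtain r t where rt: "x = plane_of_complex (of_real r * cis t)"
      "spiral_radius (t + pi) \<le> r" "r \<le> spiral_radius t" "2 * pi \<le> t"
      unfolding frontier_def using spiral_closure by blast
    have t: "3 \<le> t" using rt two_pi_ge_six by linarith
    consider "r = spiral_radius t" | "r = spiral_radius (t + pi)" | "t = 2 * pi"
      | "spiral_radius (t + pi) < r" "r < spiral_radius t" "2 * pi < t"
      using rt by fastforce
    then show ?thesis
    proof cases
      case 1
      then have "x = spiral_curve t" using rt by (simp add: spiral_curve_def)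
      then show ?thesis using rt by auto
    next
      case 2
      have "cis (t + pi) = - cis t" by (simp flip: cis_mult)
      then have "x = - spiral_curve (t + pi)"
        using 2 rt by (simp add: spiral_curve_def flip: plane_of_complex_minus)
      then have "x \<in> (\<lambda>t. - spiral_curve t) ` {2 * pi..}"
        by (intro image_eqI[of _ _ "t + pi"]) (use rt(4) pi_gt_zero in \<open>simp_all, linarith\<close>)
      then show ?thesis by blast
    next
      case 3
      have "0 \<le> r" using rt(2) spiral_radius_pos[of "t + pi"] t pi_gt3 by linarith
      moreover have "1 / t \<le> 1" using t by simp
      then have "r \<le> 1" using rt(3) spiral_radius_le_inverse[OF t] by linarith
      moreover have "x = plane_of_complex (of_real r)" using 3 rt by (simp add: complex_eq_iff)
      ultimately show ?thesis by auto
    next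
      case 4
      then have "x \<in> interior spiral_domain" using rt spiral_interior by blast
      then show ?thesis using x by (simp add: frontier_def)
    qed
  qed
qed

lemma spiral_domain_bounded: "bounded spiral_domain"
proof -
  have "norm x \<le> 1" if "x \<in> spiral_domain" for x
  proof -
    from that obtain r t where rt: "x = plane_of_complex (of_real r * cis t)"
      "spiral_radius (t + pi) \<le> r" "r < spiral_radius t" "2 * pi \<le> t"
      unfolding spiral_domain_eq by blast
    have t: "3 \<le> t" using rt two_pi_ge_six by linarith
    have "0 \<le> r" using rt(2) spiral_radius_pos[of "t + pi"] t pi_gt3 by linarith
    moreover have "1 / t \<le> 1" using t by simp
    then have "r \<le> 1" using rt(3) spiral_radius_le_inverse[OF t] by linarith
    ultimately show ?thesis using rt(1) by (simp add: norm_mult)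
  qed
  then show ?thesis unfolding bounded_iff by blast
qed

lemma spiral_frontier_content:
  obtains C where "C \<ge> 0" "\<And>h. 0 < h \<Longrightarrow> h \<le> 1 \<Longrightarrow>
    emeasure lborel (\<Union>w\<in>frontier spiral_domain. ball w h) \<le> ennreal (C * h)"
proof -
  define S where "S = (\<Sum>k. spiral_radius (2 * pi * (real k + 1)))"
  define C1 where "C1 = 4 * pi + 4 * pi * (4 * pi + 2) * S"
  have "0 \<le> S" unfolding S_def
  proof (intro suminf_nonneg summable_spiral_radius)
    fix k :: nat
    have "6 * 1 \<le> 2 * pi * (real k + 1)" by (intro mult_mono two_pi_ge_six) auto
    then show "0 \<le> spiral_radius (2 * pi * (real k + 1))" by (intro less_imp_le spiral_radius_pos) simp
  qed
  then have C1: "0 \<le> C1" by (simp add: C1_def)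
  show ?thesis
  proof
    show "0 \<le> 2 * C1 + 12 * pi" using C1 by simp
    fix h :: real assume h: "0 < h" "h \<le> 1"
    let ?N = "\<lambda>F :: (real ^ 2) set. \<Union>w\<in>F. ball w h"
    let ?F1 = "spiral_curve ` {2 * pi..}" and ?F2 = "(\<lambda>t. - spiral_curve t) ` {2 * pi..}"
      and ?F3 = "(\<lambda>r. plane_of_complex (of_real r)) ` {0..1}"
    have N: "?N F \<in> sets lborel" for F by (auto intro!: borel_open)
    have "?N (frontier spiral_domain) \<subseteq> ?N ?F1 \<union> ?N ?F2 \<union> ?N ?F3"
      by (rule order_trans[OF UN_mono[OF frontier_spiral_domain order_refl]]) (simp only: UN_Un order_refl)
    then have "emeasure lborel (?N (frontier spiral_domain)) \<le> emeasure lborel (?N ?F1 \<union> ?N ?F2 \<union> ?N ?F3)"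
      by (intro emeasure_mono sets.Un N)
    also have "\<dots> \<le> emeasure lborel (?N ?F1 \<union> ?N ?F2) + emeasure lborel (?N ?F3)"
      by (intro emeasure_subadditive sets.Un N)
    also have "\<dots> \<le> (emeasure lborel (?N ?F1) + emeasure lborel (?N ?F2)) + emeasure lborel (?N ?F3)"
      by (intro add_right_mono emeasure_subadditive N)
    also have "\<dots> \<le> (ennreal (C1 * h) + ennreal (C1 * h)) + ennreal (12 * pi * h)"
    proof (intro add_mono)
      have ge3: "3 \<le> a" if "2 * pi \<le> a" for a using that two_pi_ge_six by linarith
      have norm: "norm (spiral_curve t) = spiral_radius t" if "2 * pi \<le> t" for t
        using ge3[OF that] by (intro norm_spiral_curve) simp
      show "emeasure lborel (?N ?F1) \<le> ennreal (C1 * h)"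
        unfolding C1_def S_def
        by (rule emeasure_thickened_spiral[OF norm spiral_curve_lipschitz[OF ge3] h])
      show "emeasure lborel (?N ?F2) \<le> ennreal (C1 * h)"
        unfolding C1_def S_def
      proof (rule emeasure_thickened_spiral[OF _ _ h])
        show "norm (- spiral_curve t) = spiral_radius t" if "2 * pi \<le> t" for t
          using norm[OF that] by simp
        show "dist (- spiral_curve s) (- spiral_curve t) \<le> 2 * spiral_radius a * \<bar>s - t\<bar>"
          if "2 * pi \<le> a" "a \<le> s" "a \<le> t" for a s t
          using spiral_curve_lipschitz[OF ge3[OF that(1)] that(2,3)] by (simp only: dist_minus)
      qed
      have "emeasure lborel (?N ?F3) \<le> ennreal (4 * pi * h * (1 * (1 - 0) + 2 * h))"
      proof (rule emeasure_thickened_lipschitz_path[OF _ _ _ h(1)])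
        show "dist (plane_of_complex (of_real s)) (plane_of_complex (of_real t)) \<le> 1 * \<bar>s - t\<bar>" for s t
          by (simp only: dist_plane_of_complex dist_of_real dist_real_def mult_1_left order_refl)
      qed auto
      also have "\<dots> \<le> ennreal (4 * pi * h * 3)"
        using h by (intro ennreal_leI mult_left_mono) auto
      finally show "emeasure lborel (?N ?F3) \<le> ennreal (12 * pi * h)" by (simp add: mult_ac)
    qed
    also have "\<dots> = ennreal ((2 * C1 + 12 * pi) * h)"
      using C1 h by (simp add: ennreal_plus[symmetric] algebra_simps del: ennreal_plus)
    finally show "emeasure lborel (?N (frontier spiral_domain)) \<le> ennreal ((2 * C1 + 12 * pi) * h)" .
  qed
qed

section \<open>Besov regularity of the spiral domain\<close>

theorem theorem4p22:
  fixes \<phi>0 \<phi> :: "real ^ 2 \<Rightarrow> complex" and p :: ennreal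
  assumes "admissible_pair \<phi>0 \<phi>"
    and "1 \<le> p"
  shows "\<exists>T \<in> besov_space \<phi>0 \<phi> (enn2real (1 / p)) p.
           generated_by T (indicator spiral_domain)"
proof -
  obtain C where "C \<ge> 0" "\<And>h. 0 < h \<Longrightarrow> h \<le> 1 \<Longrightarrow>
      emeasure lborel (\<Union>w\<in>frontier spiral_domain. ball w h) \<le> ennreal (C * h)"
    using spiral_frontier_content by blast
  then show ?thesis
    by (rule indicator_in_besov_space[OF assms spiral_domain_bounded])
qed

end
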